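(* Let $Y$ and $Z$ be real Banach spaces, $\Omega$ a nonempty open subset of $Z$, and $k\in\mathbb N$. A subset $M$ of $\mathcal D^k(\Omega,Y)$ is relatively compact if and only if it is bounded, $\tau$-equicontinuous and pointwise $\tau$-relatively compact.
   Context: Differentiability is in the Fréchet sense. $\mathcal C^k(\Omega,Y)$ is the space of $k$-times continuously differentiable functions $f:\Omega\to Y$; for $p=0,\dots,k$, $d^pf:\Omega\to W_p$ is the differential of order $p$, where $W_p=\mathcal L(Z^p,Y)$ is the Banach space of bounded $p$-linear operators with the operator norm ($W_0=Y$, $d^0f=f$). $\mathcal D^k(\Omega,Y)$ is $\mathcal C^k(\Omega,Y)$ endowed with the (complete, locally convex) topology $\tau$ generated by the seminorms $\|f\|_{\mathcal C^k,K}=\max_{0\le p\le k}\sup_{x\in K}\|d^pf(x)\|$, $K\in\mathcal K$, where $\mathcal K$ is the family of all compact subsets of $\Omega$. A set is bounded in $\mathcal D^k(\Omega,Y)$ if it is bounded for each of these seminorms. A bounded set $M\subseteq\mathcal D^k(\Omega,Y)$ is $\tau$-equicontinuous if for every $K\in\mathcal K$ one has $\omega_{\mathcal D^k}(M)(K)=0$, where $\omega_{\mathcal D^k}(M)(K)$ is the maximum over $p=0,\dots,k$ of the infimum of all $\varepsilon>0$ for which there is a finite partition $\{A_1,\dots,A_n\}$ of $K$ such that, for all $f\in M$, $\operatorname{diam}_{W_p}(d^pf(A_i))\le\varepsilon$ for $i=1,\dots,n$. It is pointwise $\tau$-relatively compact if for every $K\in\mathcal K$ one has $\mu_{\alpha_\tau}(M)(K)=\max_{0\le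 p\le k}\sup_{x\in K}\alpha_p(M^p(x))=0$, where $M^p(x)=\{d^pf(x):f\in M\}\subseteq W_p$ and $\alpha_p$ is the Kuratowski measure of noncompactness in $W_p$ (infimum of all $\varepsilon>0$ such that the set can be covered by finitely many sets of diameter not greater than $\varepsilon$); equivalently, each $M^p(x)$ is relatively compact in $W_p$. *)

theory Defs
  imports "HOL-Analysis.Analysis" "HOL-Library.Disjoint_Sets"
begin

section \<open>Bounded multilinear operators\<close>

text \<open>
  The order \<open>p\<close> of a differential is a number, so the spaces \<open>W_p = L(Z^p, Y)\<close> cannot each be a
  type. They are realised as closed subspaces of one normed space, their l-infinity sum: an element
  of \<open>('z, 'y) mlin\<close> is a function on lists that is \<open>p\<close>-linear on the lists of length \<open>p\<close>, for every
  \<open>p\<close>, with a common bound. An element of \<open>W_p\<close> is one that vanishes on all lists of length other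
  than \<open>p\<close>; on \<open>W_p\<close> the norm below is the operator norm of \<open>L(Z^p, Y)\<close>.
\<close>

definition bounded_mlin :: "('z::real_normed_vector list \<Rightarrow> 'y::real_normed_vector) \<Rightarrow> bool" where
  "bounded_mlin T \<longleftrightarrow>
     (\<forall>xs i. i < length xs \<longrightarrow> linear (\<lambda>v. T (xs[i := v]))) \<and>
     (\<exists>C. \<forall>xs. norm (T xs) \<le> C * prod_list (map norm xs))"

typedef (overloaded) ('z, 'y) mlin =
  "{T :: 'z::real_normed_vector list \<Rightarrow> 'y::real_normed_vector. bounded_mlin T}"
  morphisms mlin_apply Mlin
  by (rule exI[of _ "\<lambda>_. 0"])
     (auto simp: bounded_mlin_def linear_iff intro!: exI[of _ 0])

setup_lifting type_definition_mlin

lemma bounded_mlin_bound: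
  assumes "bounded_mlin T"
  shows "\<exists>C\<ge>0. \<forall>xs. norm (T xs) \<le> C * prod_list (map norm xs)"
proof -
  obtain C where C: "\<forall>xs. norm (T xs) \<le> C * prod_list (map norm xs)"
    using assms by (auto simp: bounded_mlin_def)
  then have "0 \<le> C" using order_trans[OF norm_ge_zero C[rule_format, of "[]"]] by simp
  with C show ?thesis by blast
qed

lemma bounded_mlin_linear:
  "bounded_mlin T \<Longrightarrow> i < length xs \<Longrightarrow> linear (\<lambda>v. T (xs[i := v]))"
  by (auto simp: bounded_mlin_def)

lemma prod_list_norm_nonneg: "0 \<le> prod_list (map norm xs)"
  by (induction xs) auto

lemma bounded_mlin_0: "bounded_mlin (\<lambda>_. 0)"
  by (auto simp: bounded_mlin_def linear_iff intro!: exI[of _ 0])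

lemma bounded_mlin_scaleR:
  assumes "bounded_mlin T"
  shows "bounded_mlin (\<lambda>xs. r *\<^sub>R T xs)"
proof -
  obtain C where C: "0 \<le> C" "\<And>xs. norm (T xs) \<le> C * prod_list (map norm xs)"
    using bounded_mlin_bound[OF assms] by blast
  have "norm (r *\<^sub>R T xs) \<le> (\<bar>r\<bar> * C) * prod_list (map norm xs)" for xs
    using mult_left_mono[OF C(2)[of xs], of "\<bar>r\<bar>"] by (simp add: mult.assoc)
  then show ?thesis
    unfolding bounded_mlin_def
    by (intro conjI allI impI linear_compose_scale_right bounded_mlin_linear[OF assms]
        exI[of _ "\<bar>r\<bar> * C"])
qed

lemma bounded_mlin_add:
  assumes "bounded_mlin S" "bounded_mlin T"
  shows "bounded_mlin (\<lambda>xs. S xs + T xs)"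
proof -
  obtain C where C: "0 \<le> C" "\<And>xs. norm (S xs) \<le> C * prod_list (map norm xs)"
    using bounded_mlin_bound[OF assms(1)] by blast
  obtain D where D: "0 \<le> D" "\<And>xs. norm (T xs) \<le> D * prod_list (map norm xs)"
    using bounded_mlin_bound[OF assms(2)] by blast
  have "norm (S xs + T xs) \<le> (C + D) * prod_list (map norm xs)" for xs
    using norm_triangle_ineq[of "S xs" "T xs"] C(2)[of xs] D(2)[of xs]
    by (simp add: distrib_right)
  then show ?thesis
    unfolding bounded_mlin_def
    by (intro conjI allI impI linear_compose_add bounded_mlin_linear[OF assms(1)]
        bounded_mlin_linear[OF assms(2)] exI[of _ "C + D"])
qed

definition mlin_norm :: "('z::real_normed_vector list \<Rightarrow> 'y::real_normed_vector) \<Rightarrow> real" where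
  "mlin_norm T = (SUP xs. norm (T xs) / prod_list (map norm xs))"

lemma mlin_norm_bdd:
  assumes "bounded_mlin T"
  shows "bdd_above (range (\<lambda>xs. norm (T xs) / prod_list (map norm xs)))"
proof -
  obtain C where C: "0 \<le> C" "\<And>xs. norm (T xs) \<le> C * prod_list (map norm xs)"
    using bounded_mlin_bound[OF assms] by blast
  have "norm (T xs) / prod_list (map norm xs) \<le> C" for xs
    using C prod_list_norm_nonneg[of xs]
    by (cases "prod_list (map norm xs) = 0") (auto simp: divide_le_eq)
  then show ?thesis by (intro bdd_aboveI2[where M = C])
qed

lemma mlin_norm_le:
  assumes "bounded_mlin T"
  shows "norm (T xs) \<le> mlin_norm T * prod_list (map norm xs)"
proof (cases "prod_list (map norm xs) = 0")
  case True
  obtain C where "norm (T xs) \<le> C * prod_list (map norm xs)"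
    using bounded_mlin_bound[OF assms] by blast
  with True show ?thesis by simp
next
  case False
  then have pos: "0 < prod_list (map norm xs)"
    using prod_list_norm_nonneg[of xs] by linarith
  have "norm (T xs) / prod_list (map norm xs) \<le> mlin_norm T"
    unfolding mlin_norm_def by (rule cSUP_upper[OF UNIV_I mlin_norm_bdd[OF assms]])
  with pos show ?thesis by (simp add: divide_le_eq)
qed

lemma mlin_norm_bound:
  assumes "0 \<le> C" "\<And>xs. norm (T xs) \<le> C * prod_list (map norm xs)"
  shows "mlin_norm T \<le> C"
  unfolding mlin_norm_def
proof (rule cSUP_least)
  fix xs :: "'a list"
  show "norm (T xs) / prod_list (map norm xs) \<le> C"
    using assms prod_list_norm_nonneg[of xs]
    by (cases "prod_list (map norm xs) = 0") (auto simp: divide_le_eq)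
qed simp

lemma mlin_norm_nonneg: "bounded_mlin T \<Longrightarrow> 0 \<le> mlin_norm T"
  using order_trans[OF norm_ge_zero mlin_norm_le[of T "[]"]] by simp

instantiation mlin :: (real_normed_vector, real_normed_vector) real_normed_vector
begin

lift_definition norm_mlin :: "('a, 'b) mlin \<Rightarrow> real" is mlin_norm .

lift_definition zero_mlin :: "('a, 'b) mlin" is "\<lambda>_. 0"
  by (rule bounded_mlin_0)

lift_definition plus_mlin :: "('a, 'b) mlin \<Rightarrow> ('a, 'b) mlin \<Rightarrow> ('a, 'b) mlin"
  is "\<lambda>S T xs. S xs + T xs"
  by (rule bounded_mlin_add)

lift_definition scaleR_mlin :: "real \<Rightarrow> ('a, 'b) mlin \<Rightarrow> ('a, 'b) mlin" is "\<lambda>r T xs. r *\<^sub>R T xs"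
  by (rule bounded_mlin_scaleR)

definition uminus_mlin :: "('a, 'b) mlin \<Rightarrow> ('a, 'b) mlin" where
  "uminus_mlin T = (- 1) *\<^sub>R T"

definition minus_mlin :: "('a, 'b) mlin \<Rightarrow> ('a, 'b) mlin \<Rightarrow> ('a, 'b) mlin" where
  "minus_mlin S T = S + - T"

definition dist_mlin :: "('a, 'b) mlin \<Rightarrow> ('a, 'b) mlin \<Rightarrow> real" where
  "dist_mlin S T = norm (S - T)"

definition sgn_mlin :: "('a, 'b) mlin \<Rightarrow> ('a, 'b) mlin" where
  "sgn_mlin T = inverse (norm T) *\<^sub>R T"

definition [code del]:
  "(uniformity :: (('a, 'b) mlin \<times> ('a, 'b) mlin) filter) =
     (INF e\<in>{0 <..}. principal {(S, T). dist S T < e})"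

definition open_mlin :: "('a, 'b) mlin set \<Rightarrow> bool" where
  [code del]: "open_mlin S = (\<forall>x\<in>S. \<forall>\<^sub>F (x', y) in uniformity. x' = x \<longrightarrow> y \<in> S)"

instance
proof
  fix S T U :: "('a, 'b) mlin" and r s :: real
  show "S + T + U = S + (T + U)" "S + T = T + S" "0 + S = S"
    by (transfer; simp add: algebra_simps)+
  show "- S + S = 0" unfolding uminus_mlin_def by transfer simp
  show "S - T = S + - T" by (rule minus_mlin_def)
  show "r *\<^sub>R (S + T) = r *\<^sub>R S + r *\<^sub>R T" "(r + s) *\<^sub>R S = r *\<^sub>R S + s *\<^sub>R S"
    "r *\<^sub>R s *\<^sub>R S = (r * s) *\<^sub>R S" "1 *\<^sub>R S = S"
    by (transfer; simp add: algebra_simps)+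
  show "dist S T = norm (S - T)" by (rule dist_mlin_def)
  show "sgn S = inverse (norm S) *\<^sub>R S" by (rule sgn_mlin_def)
  show "(uniformity :: (('a, 'b) mlin \<times> ('a, 'b) mlin) filter) =
      (INF e\<in>{0 <..}. principal {(S, T). dist S T < e})"
    by (rule uniformity_mlin_def)
  show "open X = (\<forall>x\<in>X. \<forall>\<^sub>F (x', y) in uniformity. x' = x \<longrightarrow> y \<in> X)"
    for X :: "('a, 'b) mlin set"
    by (rule open_mlin_def)
  show "norm S = 0 \<longleftrightarrow> S = 0"
  proof
    assume "norm S = 0"
    then show "S = 0"
    proof transfer
      fix T :: "'a list \<Rightarrow> 'b"
      assume *: "bounded_mlin T" "mlin_norm T = 0"
      show "T = (\<lambda>_. 0)"
      proof
        fix xs show "T xs = 0" using mlin_norm_le[OF *(1), of xs] *(2) by simp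
      qed
    qed
  next
    assume "S = 0"
    then show "norm S = 0" by (simp, transfer) (simp add: mlin_norm_def)
  qed
  show "norm (S + T) \<le> norm S + norm T"
  proof transfer
    fix S T :: "'a list \<Rightarrow> 'b"
    assume *: "bounded_mlin S" "bounded_mlin T"
    show "mlin_norm (\<lambda>xs. S xs + T xs) \<le> mlin_norm S + mlin_norm T"
    proof (rule mlin_norm_bound)
      fix xs :: "'a list"
      show "norm (S xs + T xs) \<le> (mlin_norm S + mlin_norm T) * prod_list (map norm xs)"
        using norm_triangle_ineq[of "S xs" "T xs"] mlin_norm_le[OF *(1), of xs]
          mlin_norm_le[OF *(2), of xs]
        by (simp add: distrib_right)
    qed (simp add: * mlin_norm_nonneg)
  qed
  have le: "norm (r *\<^sub>R S) \<le> \<bar>r\<bar> * norm S" for r and S :: "('a, 'b) mlin"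
  proof transfer
    fix r and S :: "'a list \<Rightarrow> 'b"
    assume *: "bounded_mlin S"
    show "mlin_norm (\<lambda>xs. r *\<^sub>R S xs) \<le> \<bar>r\<bar> * mlin_norm S"
    proof (rule mlin_norm_bound)
      fix xs :: "'a list"
      show "norm (r *\<^sub>R S xs) \<le> \<bar>r\<bar> * mlin_norm S * prod_list (map norm xs)"
        using mult_left_mono[OF mlin_norm_le[OF *, of xs], of "\<bar>r\<bar>"]
        by (simp add: mult.assoc)
    qed (simp add: * mlin_norm_nonneg)
  qed
  show "norm (r *\<^sub>R S) = \<bar>r\<bar> * norm S"
  proof (cases "r = 0")
    case True
    have "0 \<le> norm (r *\<^sub>R S)" by transfer (rule mlin_norm_nonneg, rule bounded_mlin_scaleR)
    with le[of r S] True show ?thesis by simp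
  next
    case False
    have "inverse r *\<^sub>R r *\<^sub>R S = S" using False by transfer simp
    with le[of "inverse r" "r *\<^sub>R S"] have "norm S \<le> \<bar>inverse r\<bar> * norm (r *\<^sub>R S)" by simp
    then have "\<bar>r\<bar> * norm S \<le> \<bar>r\<bar> * (\<bar>inverse r\<bar> * norm (r *\<^sub>R S))"
      by (rule mult_left_mono) simp
    also have "\<dots> = norm (r *\<^sub>R S)" using False by (simp add: abs_inverse)
    finally show ?thesis using le[of r S] by simp
  qed
qed

end

lemma norm_mlin_apply: "norm (mlin_apply T xs) \<le> norm T * prod_list (map norm xs)"
  by transfer (rule mlin_norm_le)

lemma bounded_linear_mlin_apply: "bounded_linear (\<lambda>T. mlin_apply T xs)"
  by (rule bounded_linear_intro[where K = "prod_list (map norm xs)"])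
     (auto simp: plus_mlin.rep_eq scaleR_mlin.rep_eq norm_mlin_apply)

definition mlin_space :: "nat \<Rightarrow> ('z::real_normed_vector, 'y::real_normed_vector) mlin set" where
  "mlin_space p = {T. \<forall>xs. length xs \<noteq> p \<longrightarrow> mlin_apply T xs = 0}"

lift_definition mlin_const :: "'y::real_normed_vector \<Rightarrow> ('z::real_normed_vector, 'y) mlin"
  is "\<lambda>y xs. if xs = [] then y else 0"
proof -
  fix y :: 'y
  show "bounded_mlin (\<lambda>xs :: 'z list. if xs = [] then y else 0)"
    unfolding bounded_mlin_def
  proof (intro conjI allI impI)
    fix i and xs :: "'z list" assume "i < length xs"
    then show "linear (\<lambda>v. if xs[i := v] = [] then y else 0)"
      using list_update_nonempty[of xs i] by (auto simp: linear_iff)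
  next
    show "\<exists>C. \<forall>xs :: 'z list. norm (if xs = [] then y else 0) \<le> C * prod_list (map norm xs)"
      by (intro exI[of _ "norm y"]) (auto simp: prod_list_norm_nonneg)
  qed
qed

text \<open>
  The canonical isometry from \<open>L(Z, L(Z^p, Y))\<close> to \<open>L(Z^(p+1), Y)\<close>; the first argument is the
  direction of the outermost derivative.
\<close>

definition mlin_uncurry ::
    "('z::real_normed_vector \<Rightarrow>\<^sub>L ('z, 'y::real_normed_vector) mlin) \<Rightarrow> ('z, 'y) mlin" where
  "mlin_uncurry L = Mlin (\<lambda>xs. case xs of [] \<Rightarrow> 0 | h # hs \<Rightarrow> mlin_apply (blinfun_apply L h) hs)"

lemma mlin_apply_uncurry:
  fixes L :: "'z::real_normed_vector \<Rightarrow>\<^sub>L ('z, 'y::real_normed_vector) mlin"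
  shows "mlin_apply (mlin_uncurry L) xs =
     (case xs of [] \<Rightarrow> 0 | h # hs \<Rightarrow> mlin_apply (blinfun_apply L h) hs)"
proof -
  let ?T = "\<lambda>xs. case xs of [] \<Rightarrow> 0 | h # hs \<Rightarrow> mlin_apply (blinfun_apply L h) hs"
  have "bounded_mlin ?T"
    unfolding bounded_mlin_def
  proof (intro conjI allI impI)
    fix i and xs :: "'z list" assume i: "i < length xs"
    then obtain h hs where xs: "xs = h # hs" by (cases xs) auto
    show "linear (\<lambda>v. ?T (xs[i := v]))"
    proof (cases i)
      case 0
      then show ?thesis
        by (auto simp: xs linear_iff blinfun.add_right blinfun.scaleR_right
            plus_mlin.rep_eq scaleR_mlin.rep_eq)
    next
      case (Suc j)
      have "bounded_mlin (mlin_apply (blinfun_apply L h))" using mlin_apply by blast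
      from bounded_mlin_linear[OF this, of j hs] i show ?thesis by (simp add: xs Suc)
    qed
  next
    show "\<exists>C. \<forall>xs. norm (?T xs) \<le> C * prod_list (map norm xs)"
    proof (intro exI allI)
      fix xs :: "'z list" show "norm (?T xs) \<le> norm L * prod_list (map norm xs)"
      proof (cases xs)
        case (Cons h hs)
        have "norm (?T xs) \<le> norm (blinfun_apply L h) * prod_list (map norm hs)"
          by (simp add: Cons norm_mlin_apply)
        also have "\<dots> \<le> (norm L * norm h) * prod_list (map norm hs)"
          by (intro mult_right_mono norm_blinfun prod_list_norm_nonneg)
        finally show ?thesis by (simp add: Cons mult.assoc)
      qed simp
    qed
  qed
  then show ?thesis by (simp add: mlin_uncurry_def Mlin_inverse)
qed


section \<open>The space of \<open>k\<close> times continuously differentiable functions\<close>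

text \<open>
  \<open>differential p f x\<close> is \<open>d^p f(x)\<close>. It is meaningful at interior points of the domain at which \<open>f\<close>
  is \<open>p\<close> times differentiable; there the derivative is taken in the norm of \<open>W_p\<close>.
\<close>

primrec differential ::
    "nat \<Rightarrow> ('z::real_normed_vector \<Rightarrow> 'y::real_normed_vector) \<Rightarrow> 'z \<Rightarrow> ('z, 'y) mlin" where
  "differential 0 f = (\<lambda>x. mlin_const (f x))"
| "differential (Suc p) f =
     (\<lambda>x. mlin_uncurry (Blinfun (frechet_derivative (differential p f) (at x))))"

text \<open>
  A function on \<open>\<Omega>\<close> is represented by its extension with the value \<^term>\<open>undefined\<close> outside \<open>\<Omega>\<close>,
  so that functions that agree on \<open>\<Omega>\<close> are equal.
\<close>

definition Ck_on ::
    "nat \<Rightarrow> 'z::real_normed_vector set \<Rightarrow> ('z \<Rightarrow> 'y::real_normed_vector) set" where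
  "Ck_on k \<Omega> = {f \<in> extensional \<Omega>.
     (\<forall>p<k. \<forall>x\<in>\<Omega>. differential p f differentiable (at x)) \<and>
     (\<forall>p\<le>k. continuous_on \<Omega> (differential p f))}"

lemma differential_in_mlin_space:
  assumes "open \<Omega>" "f \<in> Ck_on k \<Omega>" "p \<le> k" "x \<in> \<Omega>"
  shows "differential p f x \<in> mlin_space p"
  using assms(3,4)
proof (induction p arbitrary: x)
  case 0
  then show ?case by (simp add: mlin_space_def mlin_const.rep_eq)
next
  case (Suc p)
  define F where "F = differential p f"
  define L where "L = frechet_derivative F (at x)"
  have "F differentiable (at x)" using assms(2) Suc.prems by (auto simp: Ck_on_def F_def)
  then have L: "(F has_derivative L) (at x)"
    by (simp add: L_def frechet_derivative_works)
  have "mlin_apply (L h) xs = 0" if "length xs \<noteq> p" for h xs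
  proof -
    have "((\<lambda>y. mlin_apply (F y) xs) has_derivative (\<lambda>h. mlin_apply (L h) xs)) (at x)"
      by (rule bounded_linear.has_derivative[OF bounded_linear_mlin_apply L])
    moreover have "((\<lambda>y. mlin_apply (F y) xs) has_derivative (\<lambda>h. 0)) (at x)"
    proof (rule has_derivative_transform_within_open[OF has_derivative_const assms(1)])
      show "0 = mlin_apply (F y) xs" if "y \<in> \<Omega>" for y
        using Suc.IH[OF _ that] Suc.prems \<open>length xs \<noteq> p\<close> by (simp add: mlin_space_def F_def)
    qed (rule Suc.prems)
    ultimately show ?thesis by (rule has_derivative_unique[THEN fun_cong])
  qed
  moreover have "blinfun_apply (Blinfun L) = L"
    by (rule bounded_linear_Blinfun_apply[OF has_derivative_bounded_linear[OF L]])
  ultimately show ?case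
    by (auto simp: mlin_space_def mlin_apply_uncurry F_def L_def split: list.split)
qed

text \<open>
  The seminorm for \<open>K\<close> takes values in \<^typ>\<open>ennreal\<close>, where the supremum over \<open>K = {}\<close> is 0; it is
  finite for \<open>f\<close> in \<^const>\<open>Ck_on\<close> and compact \<open>K \<subseteq> \<Omega>\<close>.
\<close>

definition Ck_seminorm ::
    "nat \<Rightarrow> 'z::real_normed_vector set \<Rightarrow> ('z \<Rightarrow> 'y::real_normed_vector) \<Rightarrow> ennreal" where
  "Ck_seminorm k K f = (MAX p\<in>{0..k}. SUP x\<in>K. ennreal (norm (differential p f x)))"

definition Dk_topology ::
    "nat \<Rightarrow> 'z::real_normed_vector set \<Rightarrow> ('z \<Rightarrow> 'y::real_normed_vector) topology" where
  "Dk_topology k \<Omega> = topology_generated_by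
     {{g \<in> Ck_on k \<Omega>. Ck_seminorm k K (\<lambda>x\<in>\<Omega>. g x - f x) < ennreal \<epsilon>} | f K \<epsilon>.
        f \<in> Ck_on k \<Omega> \<and> compact K \<and> K \<subseteq> \<Omega> \<and> 0 < \<epsilon>}"

lemma topspace_Dk_topology: "topspace (Dk_topology k \<Omega>) = Ck_on k \<Omega>"
proof -
  have "Ck_seminorm k {} f < ennreal 1" for f :: "'a \<Rightarrow> 'b"
    unfolding Ck_seminorm_def by (subst Max_less_iff) (auto simp: bot_ennreal)
  then have "f \<in> \<Union>{{g \<in> Ck_on k \<Omega>. Ck_seminorm k K (\<lambda>x\<in>\<Omega>. g x - f x) < ennreal \<epsilon>} | f K \<epsilon>.
        f \<in> Ck_on k \<Omega> \<and> compact K \<and> K \<subseteq> \<Omega> \<and> 0 < \<epsilon>}"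
    if "f \<in> Ck_on k \<Omega>" for f :: "'a \<Rightarrow> 'b"
    using that by (intro UnionI[of "{g \<in> Ck_on k \<Omega>. Ck_seminorm k {} (\<lambda>x\<in>\<Omega>. g x - f x) < ennreal 1}"])
      (blast intro: zero_less_one compact_empty empty_subsetI)+
  then show ?thesis
    unfolding Dk_topology_def topology_generated_by_topspace by blast
qed

definition Dk_bounded ::
    "nat \<Rightarrow> 'z::real_normed_vector set \<Rightarrow> ('z \<Rightarrow> 'y::real_normed_vector) set \<Rightarrow> bool" where
  "Dk_bounded k \<Omega> M \<longleftrightarrow>
     M \<subseteq> Ck_on k \<Omega> \<and>
     (\<forall>K. compact K \<and> K \<subseteq> \<Omega> \<longrightarrow> (\<exists>C::real. \<forall>f\<in>M. Ck_seminorm k K f \<le> ennreal C))"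

definition Dk_relatively_compact ::
    "nat \<Rightarrow> 'z::real_normed_vector set \<Rightarrow> ('z \<Rightarrow> 'y::real_normed_vector) set \<Rightarrow> bool" where
  "Dk_relatively_compact k \<Omega> M \<longleftrightarrow>
     compactin (Dk_topology k \<Omega>) (Dk_topology k \<Omega> closure_of M)"


section \<open>Equicontinuity and pointwise relative compactness\<close>

text \<open>
  \<^const>\<open>diameter\<close> is real-valued and carries no information on unbounded sets, hence the explicit
  boundedness. The infima below are taken in \<^typ>\<open>ennreal\<close>, so that the infimum of the empty set
  is infinite.
\<close>

definition diam_le :: "'a::metric_space set \<Rightarrow> real \<Rightarrow> bool" where
  "diam_le S \<epsilon> \<longleftrightarrow> bounded S \<and> diameter S \<le> \<epsilon>"

definition omega_Dk ::
    "nat \<Rightarrow> ('z::real_normed_vector \<Rightarrow> 'y::real_normed_vector) set \<Rightarrow> 'z set \<Rightarrow> ennreal" where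
  "omega_Dk k M K = (MAX p\<in>{0..k}. Inf {ennreal \<epsilon> | \<epsilon>. 0 < \<epsilon> \<and>
     (\<exists>P. finite P \<and> partition_on K P \<and>
        (\<forall>f\<in>M. \<forall>A\<in>P. diam_le (differential p f ` A) \<epsilon>))})"

definition tau_equicontinuous ::
    "nat \<Rightarrow> 'z::real_normed_vector set \<Rightarrow> ('z \<Rightarrow> 'y::real_normed_vector) set \<Rightarrow> bool" where
  "tau_equicontinuous k \<Omega> M \<longleftrightarrow> (\<forall>K. compact K \<and> K \<subseteq> \<Omega> \<longrightarrow> omega_Dk k M K = 0)"

text \<open>The Kuratowski measure of noncompactness of \<open>S\<close> in the metric subspace \<open>W\<close>.\<close>

definition kuratowski :: "'a::metric_space set \<Rightarrow> 'a set \<Rightarrow> ennreal" where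
  "kuratowski W S = Inf {ennreal \<epsilon> | \<epsilon>. 0 < \<epsilon> \<and>
     (\<exists>\<C>. finite \<C> \<and> \<C> \<subseteq> Pow W \<and> S \<subseteq> \<Union>\<C> \<and> (\<forall>C\<in>\<C>. diam_le C \<epsilon>))}"

definition mu_Dk ::
    "nat \<Rightarrow> ('z::real_normed_vector \<Rightarrow> 'y::real_normed_vector) set \<Rightarrow> 'z set \<Rightarrow> ennreal" where
  "mu_Dk k M K =
     (MAX p\<in>{0..k}. SUP x\<in>K. kuratowski (mlin_space p) ((\<lambda>f. differential p f x) ` M))"

definition pointwise_tau_relatively_compact ::
    "nat \<Rightarrow> 'z::real_normed_vector set \<Rightarrow> ('z \<Rightarrow> 'y::real_normed_vector) set \<Rightarrow> bool" where
  "pointwise_tau_relatively_compact k \<Omega> M \<longleftrightarrow>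
     (\<forall>K. compact K \<and> K \<subseteq> \<Omega> \<longrightarrow> mu_Dk k M K = 0)"

end

theory Submission
  imports Defs
begin

text \<open>
  A relatively compact set has finite nets for every seminorm, and the three conditions pass from
  a finite net to the whole set. Conversely, the jets \<open>(p, x) \<mapsto> d^p f(x)\<close> of the functions in \<open>M\<close>
  have a compact closure \<open>Q\<close> in the product of the \<open>W_p\<close>, by Tychonoff. Equicontinuity makes
  pointwise convergence uniform on compact sets; by the mean value inequality on segments, \<open>Q\<close>
  therefore consists of jets of \<open>C^k\<close> functions, and reading off the function is continuous from
  \<open>Q\<close> to \<open>D^k\<close>.
\<close>

section \<open>Multilinear operators\<close>

text \<open>When \<open>Z\<close> is infinite-dimensional, compact subsets of
  \<open>\<Omega>\<close> contain no balls, so uniform convergence on compact sets says nothing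
  uniform about any neighbourhood, and the classical theorem on differentiating a locally uniform
  limit does not apply. The way out is that the mean value inequality between \<open>x\<close> and
  \<open>y\<close> involves only the segment joining them, which is compact. The size of the
  neighbourhood then comes from continuity of the candidate for the next differential, not from the
  convergence. A second obstacle is that \<open>Dk_topology\<close> is generated by seminorms over
  all compact subsets, in general with no countable cofinal family, so compactness cannot be
  extracted with diagonal sequences. Closures in a product topology and finite sets of coordinates
  take their place; approximating sequences appear only after a single compact set has been fixed.
  All orders up to \<open>k\<close> are recorded as separate coordinates because pointwise
  convergence of the functions alone says nothing about their differentials.\<close>

lemma mlin_eqI: "(\<And>xs. mlin_apply S xs = mlin_apply T xs) \<Longrightarrow> S = T"
  by (simp add: mlin_apply_inject[symmetric] fun_eq_iff)

lemma mlin_apply_add: "mlin_apply (S + T) xs = mlin_apply S xs + mlin_apply T xs"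
  by (simp add: plus_mlin.rep_eq)

lemma mlin_apply_diff: "mlin_apply (S - T) xs = mlin_apply S xs - mlin_apply T xs"
  by (rule linear_diff[OF bounded_linear.linear[OF bounded_linear_mlin_apply]])

lemma mlin_apply_scaleR: "mlin_apply (r *\<^sub>R T) xs = r *\<^sub>R mlin_apply T xs"
  by (simp add: scaleR_mlin.rep_eq)

lemma bounded_mlin_mlin_apply: "bounded_mlin (mlin_apply T)"
  using mlin_apply by blast

lemma norm_mlin_le:
  assumes "0 \<le> C" "\<And>xs. norm (mlin_apply T xs) \<le> C * prod_list (map norm xs)"
  shows "norm T \<le> C"
  using mlin_norm_bound[OF assms] by (simp add: norm_mlin.rep_eq)

lemma bounded_mlin_limit:
  fixes X :: "nat \<Rightarrow> ('z::real_normed_vector, 'y::real_normed_vector) mlin"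
  assumes lim: "\<And>xs. (\<lambda>n. mlin_apply (X n) xs) \<longlonglongrightarrow> T xs" and B: "\<And>n. norm (X n) \<le> B"
  shows "bounded_mlin T"
  unfolding bounded_mlin_def
proof (intro conjI allI impI exI)
  fix xs :: "'z list" and i
  assume i: "i < length xs"
  have lin: "linear (\<lambda>v. mlin_apply (X n) (xs[i := v]))" for n
    by (rule bounded_mlin_linear[OF bounded_mlin_mlin_apply i])
  show "linear (\<lambda>v. T (xs[i := v]))"
  proof (rule linearI)
    fix u v
    have "(\<lambda>n. mlin_apply (X n) (xs[i := u + v])) \<longlonglongrightarrow> T (xs[i := u]) + T (xs[i := v])"
      unfolding linear_add[OF lin] by (intro tendsto_add lim)
    then show "T (xs[i := u + v]) = T (xs[i := u]) + T (xs[i := v])"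
      by (rule LIMSEQ_unique[OF lim])
  next
    fix r u
    have "(\<lambda>n. mlin_apply (X n) (xs[i := r *\<^sub>R u])) \<longlonglongrightarrow> r *\<^sub>R T (xs[i := u])"
      unfolding linear_scale[OF lin] by (intro tendsto_scaleR tendsto_const lim)
    then show "T (xs[i := r *\<^sub>R u]) = r *\<^sub>R T (xs[i := u])"
      by (rule LIMSEQ_unique[OF lim])
  qed
next
  fix xs :: "'z list"
  have "norm (mlin_apply (X n) xs) \<le> B * prod_list (map norm xs)" for n
    using norm_mlin_apply[of "X n" xs] mult_right_mono[OF B[of n] prod_list_norm_nonneg[of xs]]
    by linarith
  then show "norm (T xs) \<le> B * prod_list (map norm xs)"
    by (intro LIMSEQ_le_const2[OF tendsto_norm[OF lim]]) auto
qed

text \<open>Completeness turns total boundedness of the sets of values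
  \<open>differential p f x\<close> into compactness of their closures, which are the factors of the
  Tychonoff product.\<close>

instance mlin :: (real_normed_vector, banach) banach
proof
  fix X :: "nat \<Rightarrow> ('a, 'b) mlin"
  assume X: "Cauchy X"
  have "Cauchy (\<lambda>n. mlin_apply (X n) xs)" for xs
    by (rule bounded_linear.Cauchy[OF bounded_linear_mlin_apply X])
  then obtain T where T: "\<And>xs. (\<lambda>n. mlin_apply (X n) xs) \<longlonglongrightarrow> T xs"
    unfolding Cauchy_convergent_iff convergent_def by metis
  obtain B where "\<And>n. norm (X n) \<le> B"
    using Cauchy_Bseq[OF X] by (auto simp: Bseq_def)
  then have "bounded_mlin T" by (rule bounded_mlin_limit[OF T])
  then have ap: "mlin_apply (Mlin T) = T" by (simp add: Mlin_inverse)
  have "X \<longlonglongrightarrow> Mlin T"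
  proof (rule metric_LIMSEQ_I)
    fix r :: real
    assume r: "0 < r"
    then obtain N where N: "\<And>m n. N \<le> m \<Longrightarrow> N \<le> n \<Longrightarrow> dist (X m) (X n) < r / 2"
      using metric_CauchyD[OF X, of "r / 2"] by auto
    have "dist (X n) (Mlin T) < r" if n: "N \<le> n" for n
    proof -
      have "norm (X n - Mlin T) \<le> r / 2"
      proof (rule norm_mlin_le)
        fix xs :: "'a list"
        have "norm (mlin_apply (X n) xs - mlin_apply (X m) xs) \<le> r / 2 * prod_list (map norm xs)"
          if "N \<le> m" for m
          using norm_mlin_apply[of "X n - X m" xs] N[OF n that] prod_list_norm_nonneg[of xs]
            mult_right_mono[of "norm (X n - X m)" "r / 2" "prod_list (map norm xs)"]
          by (simp add: mlin_apply_diff dist_norm)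
        \<comment> \<open>Let \<open>m\<close> tend to infinity separately for each
          \<open>xs\<close>. The constant \<open>r / 2\<close> does not depend on \<open>xs\<close>,
          so the pointwise limits give a bound in norm.\<close>
        then show "norm (mlin_apply (X n - Mlin T) xs) \<le> r / 2 * prod_list (map norm xs)"
          unfolding mlin_apply_diff ap
          by (intro LIMSEQ_le_const2[OF tendsto_norm[OF tendsto_diff[OF tendsto_const T]]]) auto
      qed (use r in simp)
      with r show ?thesis by (simp add: dist_norm)
    qed
    then show "\<exists>N. \<forall>n\<ge>N. dist (X n) (Mlin T) < r" by blast
  qed
  then show "convergent X" by (rule convergentI)
qed

section \<open>Currying in the first argument\<close>

text \<open>Allows the derivative of \<open>differential p f\<close> at \<open>x\<close> to be read
  off from \<open>differential (Suc p) f x\<close> as a plain function of the direction, with no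
  \<open>Blinfun\<close> in between.\<close>

lift_definition mlin_curry ::
    "('z::real_normed_vector, 'y::real_normed_vector) mlin \<Rightarrow> 'z \<Rightarrow> ('z, 'y) mlin"
  is "\<lambda>U h hs. U (h # hs)"
proof -
  fix U :: "'z list \<Rightarrow> 'y" and h
  assume U: "bounded_mlin U"
  show "bounded_mlin (\<lambda>hs. U (h # hs))"
    unfolding bounded_mlin_def
  proof (intro conjI allI impI)
    fix i and xs :: "'z list"
    assume "i < length xs"
    then show "linear (\<lambda>v. U (h # xs[i := v]))"
      using bounded_mlin_linear[OF U, of "Suc i" "h # xs"] by simp
  next
    show "\<exists>C. \<forall>xs. norm (U (h # xs)) \<le> C * prod_list (map norm xs)"
    proof (intro exI allI)
      show "norm (U (h # xs)) \<le> (mlin_norm U * norm h) * prod_list (map norm xs)" for xs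
        using mlin_norm_le[OF U, of "h # xs"] by (simp add: mult.assoc)
    qed
  qed
qed

lemma norm_mlin_curry: "norm (mlin_curry U h) \<le> norm U * norm h"
proof (rule norm_mlin_le)
  show "norm (mlin_apply (mlin_curry U h) xs) \<le> norm U * norm h * prod_list (map norm xs)" for xs
    using norm_mlin_apply[of U "h # xs"] by (simp add: mlin_curry.rep_eq mult.assoc)
qed simp

lemma bounded_linear_mlin_curry: "bounded_linear (mlin_curry U)"
proof (rule bounded_linear_intro)
  have lin: "linear (\<lambda>v. mlin_apply U (v # xs))" for xs
    \<comment> \<open>The head \<open>undefined\<close> is a placeholder, overwritten by the update
      at position 0.\<close>
    using bounded_mlin_linear[OF bounded_mlin_mlin_apply[of U], of 0 "undefined # xs"] by simp
  show "mlin_curry U (x + y) = mlin_curry U x + mlin_curry U y" for x y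
    by (rule mlin_eqI) (simp add: mlin_curry.rep_eq mlin_apply_add linear_add[OF lin])
  show "mlin_curry U (r *\<^sub>R x) = r *\<^sub>R mlin_curry U x" for r x
    by (rule mlin_eqI) (simp add: mlin_curry.rep_eq mlin_apply_scaleR linear_scale[OF lin])
  show "norm (mlin_curry U x) \<le> norm x * norm U" for x
    using norm_mlin_curry[of U x] by (simp add: mult.commute)
qed

lemma mlin_curry_diff: "mlin_curry (U - V) h = mlin_curry U h - mlin_curry V h"
  by (rule mlin_eqI) (simp add: mlin_curry.rep_eq mlin_apply_diff)

lemma bounded_linear_mlin_curry_left: "bounded_linear (\<lambda>U. mlin_curry U h)"
proof (rule bounded_linear_intro)
  show "mlin_curry (U + V) h = mlin_curry U h + mlin_curry V h"
    for U V :: "('a::real_normed_vector, 'b::real_normed_vector) mlin"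
    by (rule mlin_eqI) (simp add: mlin_curry.rep_eq mlin_apply_add)
  show "mlin_curry (r *\<^sub>R U) h = r *\<^sub>R mlin_curry U h" for r and U :: "('a, 'b) mlin"
    by (rule mlin_eqI) (simp add: mlin_curry.rep_eq mlin_apply_scaleR)
  show "norm (mlin_curry U h) \<le> norm U * norm h" for U :: "('a, 'b) mlin"
    by (rule norm_mlin_curry)
qed

text \<open>Converts closeness of differentials of order \<open>p + 1\<close> into the operator norm
  bound on derivatives that the mean value inequality asks for.\<close>

lemma onorm_mlin_curry_diff: "onorm (mlin_curry U - mlin_curry V) \<le> norm (U - V)"
proof -
  have "mlin_curry U - mlin_curry V = mlin_curry (U - V)"
    by (rule ext) (simp add: mlin_curry_diff)
  moreover have "onorm (mlin_curry (U - V)) \<le> norm (U - V)"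
    by (intro onorm_bound norm_mlin_curry norm_ge_zero)
  ultimately show ?thesis by simp
qed

lemma mlin_curry_uncurry: "mlin_curry (mlin_uncurry L) = blinfun_apply L"
  by (rule ext, rule mlin_eqI) (simp add: mlin_curry.rep_eq mlin_apply_uncurry)

text \<open>Currying forgets the value on the empty list and \<open>mlin_uncurry\<close> puts 0
  there, hence the hypothesis.\<close>

lemma mlin_uncurry_curry:
  assumes "mlin_apply U [] = 0"
  shows "mlin_uncurry (Blinfun (mlin_curry U)) = U"
  by (rule mlin_eqI)
    (auto simp: mlin_apply_uncurry bounded_linear_Blinfun_apply[OF bounded_linear_mlin_curry]
      mlin_curry.rep_eq assms split: list.split)

lemma mlin_const_apply:
  assumes "T \<in> mlin_space 0"
  shows "mlin_const (mlin_apply T []) = T"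
  using assms by (intro mlin_eqI) (auto simp: mlin_const.rep_eq mlin_space_def)

lemma mlin_const_diff: "mlin_const (a - b) = mlin_const a - mlin_const b"
  by (rule mlin_eqI) (simp add: mlin_const.rep_eq mlin_apply_diff)

text \<open>Keeps limits of differentials homogeneous of their order: a limit of order 0 is
  determined by its value on the empty list, and a limit of higher order vanishes there.\<close>

lemma closed_mlin_space:
  "closed (mlin_space p :: ('z::real_normed_vector, 'y::real_normed_vector) mlin set)"
proof -
  have "(mlin_space p :: ('z, 'y) mlin set) = (\<Inter>xs\<in>{xs. length xs \<noteq> p}. {T. mlin_apply T xs = 0})"
    by (auto simp: mlin_space_def)
  moreover have "closed {T :: ('z, 'y) mlin. mlin_apply T xs = 0}" for xs
    by (intro closed_Collect_eq continuous_on_const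
        linear_continuous_on[OF bounded_linear_mlin_apply])
  ultimately show ?thesis by (simp add: closed_INT)
qed


section \<open>Differentials\<close>

lemma differential_Suc_eqI:
  assumes "(differential p f has_derivative mlin_curry U) (at x)" "mlin_apply U [] = 0"
  shows "differential (Suc p) f x = U"
  using frechet_derivative_at[OF assms(1)] mlin_uncurry_curry[OF assms(2)] by simp

lemma differential_Suc_Nil: "mlin_apply (differential (Suc p) f x) [] = 0"
  by (simp add: mlin_apply_uncurry)

lemma has_derivative_differential:
  assumes "f \<in> Ck_on k \<Omega>" "p < k" "x \<in> \<Omega>"
  shows "(differential p f has_derivative mlin_curry (differential (Suc p) f x)) (at x)"
proof -
  define L where "L = frechet_derivative (differential p f) (at x)"
  have L: "(differential p f has_derivative L) (at x)"
    using assms by (simp add: Ck_on_def L_def frechet_derivative_works)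
  then have "blinfun_apply (Blinfun L) = L"
    by (intro bounded_linear_Blinfun_apply has_derivative_bounded_linear)
  with L show ?thesis by (simp add: mlin_curry_uncurry L_def)
qed

lemma continuous_on_differential:
  "f \<in> Ck_on k \<Omega> \<Longrightarrow> p \<le> k \<Longrightarrow> continuous_on \<Omega> (differential p f)"
  by (simp add: Ck_on_def)

text \<open>The restricted difference is \<open>undefined\<close> off \<open>\<Omega>\<close>, so
  the induction hypothesis is an identity on \<open>\<Omega>\<close> only. Openness of
  \<open>\<Omega>\<close> makes this enough for the derivative at \<open>x\<close>.\<close>

lemma differential_diff:
  assumes "open \<Omega>" "f \<in> Ck_on k \<Omega>" "g \<in> Ck_on k \<Omega>" "p \<le> k" "x \<in> \<Omega>"
  shows "differential p (\<lambda>x\<in>\<Omega>. g x - f x) x = differential p g x - differential p f x"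
  using assms(4,5)
proof (induction p arbitrary: x)
  case 0
  then show ?case by (simp add: mlin_const_diff)
next
  case (Suc p)
  have "((\<lambda>x. differential p g x - differential p f x) has_derivative
      mlin_curry (differential (Suc p) g x - differential (Suc p) f x)) (at x)"
    unfolding mlin_curry_diff
    using Suc.prems assms(2,3) by (intro has_derivative_diff has_derivative_differential) auto
  then have "(differential p (\<lambda>x\<in>\<Omega>. g x - f x) has_derivative
      mlin_curry (differential (Suc p) g x - differential (Suc p) f x)) (at x)"
    using Suc.prems
    by (elim has_derivative_transform_within_open[OF _ assms(1)]) (simp_all only: Suc.IH Suc_leD)
  then show ?case
    by (rule differential_Suc_eqI) (simp only: mlin_apply_diff differential_Suc_Nil diff_self)
qed

section \<open>Closure of C^k under uniform approximation on compact sets\<close>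

text \<open>A convergent sequence together with its limit is compact, so compact sets detect
  continuity in a metric space even without local compactness.\<close>

lemma continuous_on_if_continuous_on_compacts:
  fixes f :: "'a::metric_space \<Rightarrow> 'b::topological_space"
  assumes "\<And>K. compact K \<Longrightarrow> K \<subseteq> S \<Longrightarrow> continuous_on K f"
  shows "continuous_on S f"
  unfolding continuous_on_sequentially
proof (intro allI impI ballI, elim conjE)
  fix u a
  assume u: "\<forall>n. u n \<in> S" "u \<longlonglongrightarrow> a" and a: "a \<in> S"
  let ?K = "insert a (range u)"
  have "compact ?K"
    using compactin_sequence_with_limit[of euclidean u a] u(2) by simp
  then have "continuous_on ?K f" using u(1) a by (intro assms) auto
  then show "(f \<circ> u) \<longlonglongrightarrow> f a"
    using u(2) unfolding continuous_on_sequentially by auto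
qed

text \<open>\<open>F p\<close> is the candidate for the differential of order \<open>p\<close>. The
  approximant may depend on \<open>K\<close> and \<open>\<epsilon>\<close>, since no single sequence
  need serve all compact sets.\<close>

lemma Ck_on_complete:
  fixes \<Omega> :: "'z::banach set" and F :: "nat \<Rightarrow> 'z \<Rightarrow> ('z, 'y::banach) mlin"
  assumes "open \<Omega>"
    and approx: "\<And>K \<epsilon>. compact K \<Longrightarrow> K \<subseteq> \<Omega> \<Longrightarrow> 0 < \<epsilon> \<Longrightarrow>
      \<exists>f\<in>Ck_on k \<Omega>. \<forall>p\<le>k. \<forall>x\<in>K. dist (differential p f x) (F p x) \<le> \<epsilon>"
  shows "\<exists>g\<in>Ck_on k \<Omega>. \<forall>p\<le>k. \<forall>x\<in>\<Omega>. differential p g x = F p x"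
proof -
  have seq: "\<exists>f. (\<forall>n. f n \<in> Ck_on k \<Omega>) \<and>
      (\<forall>n. \<forall>p\<le>k. \<forall>x\<in>K. dist (differential p (f n) x) (F p x) \<le> inverse (real (Suc n)))"
    if "compact K" "K \<subseteq> \<Omega>" for K
  proof -
    have "\<forall>n. \<exists>f. f \<in> Ck_on k \<Omega> \<and>
        (\<forall>p\<le>k. \<forall>x\<in>K. dist (differential p f x) (F p x) \<le> inverse (real (Suc n)))"
      using approx[OF that] by (simp add: Bex_def)
    from choice[OF this] show ?thesis by blast
  qed
  have lim: "uniform_limit K (\<lambda>n. differential p (f n)) (F p) sequentially"
    if "\<forall>n. \<forall>p\<le>k. \<forall>x\<in>K. dist (differential p (f n) x) (F p x) \<le> inverse (real (Suc n))" "p \<le> k"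
    for K f p
  proof (rule uniform_limitI)
    fix e :: real
    assume "0 < e"
    then have "\<forall>\<^sub>F n in sequentially. inverse (real (Suc n)) < e"
      by (rule order_tendstoD[OF LIMSEQ_inverse_real_of_nat])
    then show "\<forall>\<^sub>F n in sequentially. \<forall>x\<in>K. dist (differential p (f n) x) (F p x) < e"
      by (rule eventually_mono) (meson that le_less_trans)
  qed
  have cont: "continuous_on \<Omega> (F p)" if p: "p \<le> k" for p
  proof (rule continuous_on_if_continuous_on_compacts)
    fix K
    assume K: "compact K" "K \<subseteq> \<Omega>"
    obtain f where f: "\<And>n. f n \<in> Ck_on k \<Omega>"
      "uniform_limit K (\<lambda>n. differential p (f n)) (F p) sequentially"
      using seq[OF K] lim[OF _ p] by blast
    have "continuous_on K (differential p (f n))" for n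
      by (rule continuous_on_subset[OF continuous_on_differential[OF f(1) p] K(2)])
    then show "continuous_on K (F p)"
      by (intro uniform_limit_theorem[OF _ f(2)] always_eventually) auto
  qed
  have space: "F p x \<in> mlin_space p" if p: "p \<le> k" and x: "x \<in> \<Omega>" for p x
  proof -
    obtain f where f: "\<And>n. f n \<in> Ck_on k \<Omega>"
      "uniform_limit {x} (\<lambda>n. differential p (f n)) (F p) sequentially"
      using seq[OF compact_sing[of x]] lim[OF _ p, of "{x}"] x by blast
    show ?thesis
      using differential_in_mlin_space[OF assms(1) f(1) p x] tendsto_uniform_limitI[OF f(2)]
      by (intro Lim_in_closed_set[OF closed_mlin_space]) auto
  qed
  have deriv: "(F p has_derivative mlin_curry (F (Suc p) x)) (at x)"
    if p: "p < k" and x: "x \<in> \<Omega>" for p x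
    unfolding has_derivative_at_alt
  proof (intro conjI allI impI bounded_linear_mlin_curry)
    fix e :: real
    assume e: "0 < e"
    \<comment> \<open>\<open>d1\<close> keeps the segment from \<open>x\<close> to \<open>y\<close>
      inside \<open>\<Omega>\<close>; \<open>d2\<close> makes \<open>F (Suc p)\<close> oscillate by
      less than \<open>e\<close> along it. Neither depends on any approximating sequence.\<close>
    obtain d1 where d1: "0 < d1" "ball x d1 \<subseteq> \<Omega>"
      using assms(1) x open_contains_ball by blast
    obtain d2 where d2: "0 < d2" "\<And>y. y \<in> \<Omega> \<Longrightarrow> dist y x < d2 \<Longrightarrow> dist (F (Suc p) y) (F (Suc p) x) < e"
      using cont[of "Suc p"] p x e unfolding continuous_on_iff by (meson Suc_leI)
    have "norm (F p y - F p x - mlin_curry (F (Suc p) x) (y - x)) \<le> e * norm (y - x)"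
      if y: "norm (y - x) < min d1 d2" for y
    proof -
      let ?S = "closed_segment x y"
      have xy: "x \<in> ball x (min d1 d2)" "y \<in> ball x (min d1 d2)"
        using d1(1) d2(1) y by (auto simp: dist_norm norm_minus_commute)
      then have S: "?S \<subseteq> ball x (min d1 d2)" by (intro closed_segment_subset convex_ball)
      then have S\<Omega>: "?S \<subseteq> \<Omega>" using d1(2) by (meson min.cobounded1 subset_ball subset_trans)
      \<comment> \<open>This sequence is chosen for the one segment at hand and changes with
        \<open>y\<close>.\<close>
      obtain f where f: "\<And>n. f n \<in> Ck_on k \<Omega>"
        "\<forall>n. \<forall>p\<le>k. \<forall>x\<in>?S. dist (differential p (f n) x) (F p x) \<le> inverse (real (Suc n))"
        using seq[OF compact_segment S\<Omega>] by blast
      have tend: "(\<lambda>n. differential q (f n) z) \<longlonglongrightarrow> F q z" if "q \<le> k" "z \<in> ?S" for q z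
        using tendsto_uniform_limitI[OF lim[OF f(2)]] that by blast
      \<comment> \<open>The term \<open>e\<close> bounds the variation of \<open>F (Suc p)\<close>
        between \<open>z\<close> and \<open>x\<close>; the two inverses are the approximation errors
        at \<open>z\<close> and at \<open>x\<close>, and vanish in the limit.\<close>
      have bound: "norm (differential p (f n) y - differential p (f n) x
          - mlin_curry (differential (Suc p) (f n) x) (y - x))
          \<le> norm (y - x) * (e + 2 * inverse (real (Suc n)))" for n
      proof (rule differentiable_bound_linearization[where S = ?S])
        show "x + t *\<^sub>R (y - x) \<in> ?S" if "t \<in> {0..1}" for t
          using that by (auto simp: closed_segment_def algebra_simps intro!: exI[of _ t])
        show "(differential p (f n) has_derivative mlin_curry (differential (Suc p) (f n) z))
            (at z within ?S)" if "z \<in> ?S" for z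
          using has_derivative_differential[OF f(1) p] that S\<Omega> has_derivative_at_withinI by blast
        show "onorm (mlin_curry (differential (Suc p) (f n) z)
            - mlin_curry (differential (Suc p) (f n) x)) \<le> e + 2 * inverse (real (Suc n))"
          if z: "z \<in> ?S" for z
        proof -
          have 1: "dist (differential (Suc p) (f n) z) (F (Suc p) z) \<le> inverse (real (Suc n))"
            "dist (differential (Suc p) (f n) x) (F (Suc p) x) \<le> inverse (real (Suc n))"
            using f(2) p z by (meson Suc_leI ends_in_segment(1))+
          have 2: "dist (F (Suc p) z) (F (Suc p) x) < e"
            using z S S\<Omega> by (intro d2(2)) (auto simp: dist_commute)
          have "norm (differential (Suc p) (f n) z - differential (Suc p) (f n) x)
              \<le> e + 2 * inverse (real (Suc n))"
            unfolding dist_norm[symmetric] using 1 2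
              dist_triangle[of "differential (Suc p) (f n) z" "differential (Suc p) (f n) x" "F (Suc p) z"]
              dist_triangle[of "F (Suc p) z" "differential (Suc p) (f n) x" "F (Suc p) x"]
            by (simp only: dist_commute)
          with onorm_mlin_curry_diff show ?thesis by (rule order_trans)
        qed
      qed simp
      have "norm (F p y - F p x - mlin_curry (F (Suc p) x) (y - x)) \<le> norm (y - x) * (e + 2 * 0)"
      proof (rule LIMSEQ_le)
        show "(\<lambda>n. norm (differential p (f n) y - differential p (f n) x
            - mlin_curry (differential (Suc p) (f n) x) (y - x)))
            \<longlonglongrightarrow> norm (F p y - F p x - mlin_curry (F (Suc p) x) (y - x))"
          using p by (intro tendsto_norm tendsto_diff tend
              bounded_linear.tendsto[OF bounded_linear_mlin_curry_left]) auto
        show "(\<lambda>n. norm (y - x) * (e + 2 * inverse (real (Suc n)))) \<longlonglongrightarrow> norm (y - x) * (e + 2 * 0)"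
          by (intro tendsto_intros LIMSEQ_inverse_real_of_nat)
      qed (intro exI allI impI bound)
      then show ?thesis by (simp add: mult.commute)
    qed
    then show "\<exists>d>0. \<forall>y. norm (y - x) < d \<longrightarrow>
        norm (F p y - F p x - mlin_curry (F (Suc p) x) (y - x)) \<le> e * norm (y - x)"
      using d1(1) d2(1) by (intro exI[of _ "min d1 d2"]) auto
  qed
  \<comment> \<open>\<open>F 0 x\<close> lies in \<open>mlin_space 0\<close>, so it is a constant
    operator; evaluation on the empty list recovers the constant.\<close>
  define g where "g = (\<lambda>x\<in>\<Omega>. mlin_apply (F 0 x) [])"
  have derivI: "(differential p g has_derivative mlin_curry (F (Suc p) x)) (at x)"
    if "\<And>x. x \<in> \<Omega> \<Longrightarrow> differential p g x = F p x" "p < k" "x \<in> \<Omega>" for p x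
    by (rule has_derivative_transform_within_open[OF deriv assms(1)]) (use that in auto)
  have eq: "differential p g x = F p x" if "p \<le> k" "x \<in> \<Omega>" for p x
    using that
  proof (induction p arbitrary: x)
    case 0
    then show ?case using mlin_const_apply[OF space[OF 0]] by (simp add: g_def)
  next
    case (Suc p)
    have "mlin_apply (F (Suc p) x) [] = 0"
      using space[OF Suc.prems] by (simp add: mlin_space_def)
    then show ?case
      by (intro differential_Suc_eqI derivI) (use Suc in auto)
  qed
  have "g \<in> Ck_on k \<Omega>"
    unfolding Ck_on_def
  proof (intro CollectI conjI allI impI ballI)
    show "differential p g differentiable at x" if "p < k" "x \<in> \<Omega>" for p x
      using derivI[of p x] eq that by (auto simp: differentiable_def)
    show "continuous_on \<Omega> (differential p g)" if "p \<le> k" for p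
      by (rule continuous_on_eq[OF cont[OF that]]) (simp add: eq[OF that])
  qed (simp add: g_def)
  with eq show ?thesis by blast
qed



section \<open>Characterisations of the seminorms and measures\<close>

lemma Ck_seminorm_le_iff:
  assumes "0 \<le> C"
  shows "Ck_seminorm k K f \<le> ennreal C \<longleftrightarrow> (\<forall>p\<le>k. \<forall>x\<in>K. norm (differential p f x) \<le> C)"
  unfolding Ck_seminorm_def using assms
  by (subst Max_le_iff) (auto simp: SUP_le_iff)

text \<open>A strict bound on a supremum is stronger than strict pointwise bounds, which is why a
  uniform \<open>\<delta>\<close> below \<open>\<epsilon>\<close> appears. The gap between them is
  later the room in which a ball is shown to be open.\<close>

lemma Ck_seminorm_less_iff:
  assumes "0 < \<epsilon>"
  shows "Ck_seminorm k K f < ennreal \<epsilon> \<longleftrightarrow>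
    (\<exists>\<delta>\<ge>0. \<delta> < \<epsilon> \<and> (\<forall>p\<le>k. \<forall>x\<in>K. norm (differential p f x) \<le> \<delta>))"
proof
  assume less: "Ck_seminorm k K f < ennreal \<epsilon>"
  define \<delta> where "\<delta> = enn2real (Ck_seminorm k K f)"
  have eq: "ennreal \<delta> = Ck_seminorm k K f"
    unfolding \<delta>_def using less by (intro ennreal_enn2real) (auto intro: less_trans)
  have "0 \<le> \<delta>" by (simp add: \<delta>_def)
  moreover have "\<delta> < \<epsilon>" using less \<open>0 \<le> \<delta>\<close> by (simp add: eq[symmetric] ennreal_less_iff)
  ultimately show "\<exists>\<delta>\<ge>0. \<delta> < \<epsilon> \<and> (\<forall>p\<le>k. \<forall>x\<in>K. norm (differential p f x) \<le> \<delta>)"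
    using Ck_seminorm_le_iff[of \<delta> k K f] eq by auto
next
  assume "\<exists>\<delta>\<ge>0. \<delta> < \<epsilon> \<and> (\<forall>p\<le>k. \<forall>x\<in>K. norm (differential p f x) \<le> \<delta>)"
  then obtain \<delta> where \<delta>: "0 \<le> \<delta>" "\<delta> < \<epsilon>" "Ck_seminorm k K f \<le> ennreal \<delta>"
    using Ck_seminorm_le_iff by blast
  note \<delta>(3)
  also have "ennreal \<delta> < ennreal \<epsilon>" using \<delta> by (simp add: ennreal_less_iff)
  finally show "Ck_seminorm k K f < ennreal \<epsilon>" .
qed

lemma Dk_ball_eq:
  assumes "open \<Omega>" "f \<in> Ck_on k \<Omega>" "K \<subseteq> \<Omega>" "0 < \<epsilon>"
  shows "{g \<in> Ck_on k \<Omega>. Ck_seminorm k K (\<lambda>x\<in>\<Omega>. g x - f x) < ennreal \<epsilon>} =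
    {g \<in> Ck_on k \<Omega>. \<exists>\<delta>\<ge>0. \<delta> < \<epsilon> \<and>
      (\<forall>p\<le>k. \<forall>x\<in>K. dist (differential p g x) (differential p f x) \<le> \<delta>)}"
proof -
  have "norm (differential p (\<lambda>x\<in>\<Omega>. g x - f x) x) = dist (differential p g x) (differential p f x)"
    if "g \<in> Ck_on k \<Omega>" "p \<le> k" "x \<in> K" for g p x
    using differential_diff[OF assms(1,2) that(1,2)] that(3) assms(3) by (auto simp: dist_norm)
  then show ?thesis
    unfolding Ck_seminorm_less_iff[OF assms(4)] by (intro Collect_cong conj_cong refl) simp
qed

lemma openin_Dk_ball:
  assumes "open \<Omega>" "f \<in> Ck_on k \<Omega>" "compact K" "K \<subseteq> \<Omega>" "0 < \<epsilon>"
  shows "openin (Dk_topology k \<Omega>) {g \<in> Ck_on k \<Omega>. \<exists>\<delta>\<ge>0. \<delta> < \<epsilon> \<and>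
      (\<forall>p\<le>k. \<forall>x\<in>K. dist (differential p g x) (differential p f x) \<le> \<delta>)}"
  unfolding Dk_ball_eq[OF assms(1,2,4,5), symmetric] Dk_topology_def
  by (rule topology_generated_by_Basis) (use assms in blast)

section \<open>From diameters, partitions and coverings to finite nets\<close>

lemma diam_leI:
  fixes S :: "'a::real_normed_vector set"
  assumes "0 \<le> \<epsilon>" "\<And>x y. x \<in> S \<Longrightarrow> y \<in> S \<Longrightarrow> dist x y \<le> \<epsilon>"
  shows "diam_le S \<epsilon>"
  using assms unfolding diam_le_def bounded_two_points dist_norm
  by (auto intro!: diameter_le)

lemma diam_leD: "diam_le S \<epsilon> \<Longrightarrow> x \<in> S \<Longrightarrow> y \<in> S \<Longrightarrow> dist x y \<le> \<epsilon>"
  using diameter_bounded_bound order_trans unfolding diam_le_def by blast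

lemma diam_le_mono: "diam_le S \<delta> \<Longrightarrow> \<delta> \<le> \<epsilon> \<Longrightarrow> diam_le S \<epsilon>"
  by (simp add: diam_le_def)

text \<open>The shape shared by \<open>omega_Dk\<close> and \<open>kuratowski\<close>. Monotonicity
  lets a witness below \<open>\<epsilon>\<close> serve for \<open>\<epsilon>\<close>.\<close>

lemma Inf_ennreal_eq_0_iff:
  assumes "\<And>\<delta> \<epsilon>. Q \<delta> \<Longrightarrow> \<delta> \<le> \<epsilon> \<Longrightarrow> Q \<epsilon>"
  shows "Inf {ennreal \<epsilon> | \<epsilon>. 0 < \<epsilon> \<and> Q \<epsilon>} = 0 \<longleftrightarrow> (\<forall>\<epsilon>>0. Q \<epsilon>)"
    (is "Inf ?A = 0 \<longleftrightarrow> _")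
proof (intro iffI allI impI)
  fix \<epsilon> :: real
  assume "Inf ?A = 0" "0 < \<epsilon>"
  then have "Inf ?A < ennreal \<epsilon>" by simp
  then obtain \<delta> where "0 < \<delta>" "Q \<delta>" "ennreal \<delta> < ennreal \<epsilon>"
    unfolding Inf_less_iff by blast
  then show "Q \<epsilon>" using assms[of \<delta> \<epsilon>] by (simp add: ennreal_less_iff)
next
  assume Q: "\<forall>\<epsilon>>0. Q \<epsilon>"
  show "Inf ?A = 0"
  proof (rule ccontr)
    assume "Inf ?A \<noteq> 0"
    \<comment> \<open>Such an \<open>x\<close> is finite and positive, so its real value belongs to
      the set and contradicts the choice below the infimum.\<close>
    then obtain x where x: "0 < x" "x < Inf ?A"
      using dense[of 0 "Inf ?A"] by (auto simp: zero_less_iff_neq_zero)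
    then have top: "x < top" by (auto intro: less_le_trans)
    then have "0 < enn2real x" using x(1) by (simp add: enn2real_positive_iff)
    then have "ennreal (enn2real x) \<in> ?A" using Q by blast
    then have "Inf ?A \<le> x" using top by (simp add: Inf_lower)
    then show False using x(2) by simp
  qed
qed

lemma Max_ennreal_eq_0_iff:
  fixes F :: "nat \<Rightarrow> ennreal"
  shows "(MAX p\<in>{0..k}. F p) = 0 \<longleftrightarrow> (\<forall>p\<le>k. F p = 0)"
proof -
  have "(MAX p\<in>{0..k}. F p) \<le> 0 \<longleftrightarrow> (\<forall>p\<le>k. F p \<le> 0)"
    by (subst Max_le_iff) auto
  then show ?thesis by simp
qed

text \<open>Grouping points by the net point assigned to them turns a finite net into a partition.
  The empty fibres are removed because blocks of a partition are nonempty.\<close>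

lemma finite_partition_fibres:
  assumes "finite X" "c ` K \<subseteq> X"
  shows "\<exists>P. finite P \<and> partition_on K P \<and> (\<forall>A\<in>P. \<forall>x\<in>A. \<forall>y\<in>A. c x = c y)"
proof (intro exI conjI)
  let ?P = "(\<lambda>y. {x \<in> K. c x = y}) ` X - {{}}"
  show "finite ?P" using assms(1) by simp
  show "partition_on K ?P"
    using assms(2) by (intro partition_onI) (auto simp: disjnt_def)
  show "\<forall>A\<in>?P. \<forall>x\<in>A. \<forall>y\<in>A. c x = c y" by auto
qed

text \<open>One representative per block gives the net, and taking the union over
  \<open>p \<le> k\<close> makes it common to all orders. Conversely, two points with the same net
  point are compared through it, at the cost of halving \<open>\<epsilon>\<close>.\<close>

lemma omega_Dk_eq_0_iff:
  "omega_Dk k M K = 0 \<longleftrightarrow> (\<forall>\<epsilon>>0. \<exists>X. finite X \<and> X \<subseteq> K \<and>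
    (\<forall>p\<le>k. \<forall>x\<in>K. \<exists>y\<in>X. \<forall>f\<in>M. dist (differential p f x) (differential p f y) \<le> \<epsilon>))"
    (is "_ \<longleftrightarrow> ?R")
proof -
  have "omega_Dk k M K = 0 \<longleftrightarrow> (\<forall>p\<le>k. \<forall>\<epsilon>>0. \<exists>P. finite P \<and> partition_on K P \<and>
      (\<forall>f\<in>M. \<forall>A\<in>P. diam_le (differential p f ` A) \<epsilon>))" (is "_ \<longleftrightarrow> ?L")
    unfolding omega_Dk_def Max_ennreal_eq_0_iff
    by (intro all_cong Inf_ennreal_eq_0_iff) (meson diam_le_mono)
  also have "?L \<longleftrightarrow> ?R"
  proof (intro iffI allI impI)
    fix \<epsilon> :: real
    assume L: ?L and \<epsilon>: "0 < \<epsilon>"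
    define R where "R p P \<longleftrightarrow> finite P \<and> partition_on K P \<and>
        (\<forall>f\<in>M. \<forall>A\<in>P. diam_le (differential p f ` A) \<epsilon>)" for p P
    have "\<exists>P. R p P" if "p \<le> k" for p
      using L that \<epsilon> unfolding R_def by simp
    then obtain P where "\<And>p. p \<le> k \<Longrightarrow> R p (P p)" by metis
    then have P: "\<And>p. p \<le> k \<Longrightarrow> finite (P p)"
      "\<And>p. p \<le> k \<Longrightarrow> partition_on K (P p)"
      "\<And>p f A. p \<le> k \<Longrightarrow> f \<in> M \<Longrightarrow> A \<in> P p \<Longrightarrow> diam_le (differential p f ` A) \<epsilon>"
      unfolding R_def by simp_all
    define c where "c A = (SOME a. a \<in> A)" for A :: "'a set"
    have c: "c A \<in> A" if "p \<le> k" "A \<in> P p" for p A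
      unfolding c_def using partition_onD3[OF P(2)[OF that(1)]] that(2)
      by (subst some_in_eq) auto
    show "\<exists>X. finite X \<and> X \<subseteq> K \<and>
      (\<forall>p\<le>k. \<forall>x\<in>K. \<exists>y\<in>X. \<forall>f\<in>M. dist (differential p f x) (differential p f y) \<le> \<epsilon>)"
    proof (intro exI[of _ "\<Union>p\<le>k. c ` P p"] conjI allI impI ballI)
      show "finite (\<Union>p\<le>k. c ` P p)" using P(1) by simp
      show "(\<Union>p\<le>k. c ` P p) \<subseteq> K" using c partition_onD1[OF P(2)] by blast
    next
      fix p x
      assume p: "p \<le> k" and "x \<in> K"
      then obtain A where A: "A \<in> P p" "x \<in> A" using partition_onD1[OF P(2)[OF p]] by auto
      have "dist (differential p f x) (differential p f (c A)) \<le> \<epsilon>" if "f \<in> M" for f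
        by (intro diam_leD[OF P(3)[OF p that A(1)]] imageI A(2) c[OF p A(1)])
      then show "\<exists>y\<in>\<Union>p\<le>k. c ` P p. \<forall>f\<in>M. dist (differential p f x) (differential p f y) \<le> \<epsilon>"
        using p A(1) by blast
    qed
  next
    fix p and \<epsilon> :: real
    assume R: ?R and p: "p \<le> k" and \<epsilon>: "0 < \<epsilon>"
    obtain X where X: "finite X"
      "\<forall>x\<in>K. \<exists>y. y \<in> X \<and> (\<forall>f\<in>M. dist (differential p f x) (differential p f y) \<le> \<epsilon> / 2)"
      using R[rule_format, OF half_gt_zero[OF \<epsilon>]] p unfolding Bex_def by blast
    from bchoice[OF X(2)] obtain c where "\<forall>x\<in>K. c x \<in> X \<and>
        (\<forall>f\<in>M. dist (differential p f x) (differential p f (c x)) \<le> \<epsilon> / 2)" ..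
    then have c: "\<And>x. x \<in> K \<Longrightarrow> c x \<in> X"
      "\<And>x f. x \<in> K \<Longrightarrow> f \<in> M \<Longrightarrow> dist (differential p f x) (differential p f (c x)) \<le> \<epsilon> / 2"
      by simp_all
    have "c ` K \<subseteq> X" using c(1) by auto
    from finite_partition_fibres[OF X(1) this]
    obtain P where P: "finite P" "partition_on K P" "\<forall>A\<in>P. \<forall>x\<in>A. \<forall>y\<in>A. c x = c y"
      by (elim exE conjE)
    have "diam_le (differential p f ` A) \<epsilon>" if f: "f \<in> M" and A: "A \<in> P" for f A
    proof (rule diam_leI)
      fix u v
      assume "u \<in> differential p f ` A" "v \<in> differential p f ` A"
      then obtain x y where xy: "x \<in> A" "y \<in> A" "u = differential p f x" "v = differential p f y"
        by blast
      have "x \<in> K" "y \<in> K" using xy(1,2) A partition_onD1[OF P(2)] by auto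
      then show "dist u v \<le> \<epsilon>"
        using c(2)[OF _ f, of x] c(2)[OF _ f, of y] P(3)[rule_format, OF A xy(1,2)]
          dist_triangle2[of u v "differential p f (c x)"] by (simp add: xy(3,4))
    qed (use \<epsilon> in simp)
    with P(1,2) show "\<exists>P. finite P \<and> partition_on K P \<and>
        (\<forall>f\<in>M. \<forall>A\<in>P. diam_le (differential p f ` A) \<epsilon>)" by (intro exI[of _ P]) simp
  qed
  finally show ?thesis .
qed

text \<open>Covering sets must lie in \<open>W\<close>, but the centres of balls need not.
  Intersecting the balls with \<open>W\<close> still covers \<open>S\<close>, since \<open>S\<close>
  is a subset of \<open>W\<close>.\<close>

lemma kuratowski_eq_0_iff:
  fixes S :: "'a::real_normed_vector set"
  assumes "S \<subseteq> W"
  shows "kuratowski W S = 0 \<longleftrightarrow> (\<forall>\<epsilon>>0. \<exists>C. finite C \<and> S \<subseteq> (\<Union>c\<in>C. cball c \<epsilon>))"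
    (is "_ \<longleftrightarrow> ?R")
proof -
  have "kuratowski W S = 0 \<longleftrightarrow> (\<forall>\<epsilon>>0. \<exists>\<C>. finite \<C> \<and> \<C> \<subseteq> Pow W \<and> S \<subseteq> \<Union>\<C> \<and>
      (\<forall>C\<in>\<C>. diam_le C \<epsilon>))" (is "_ \<longleftrightarrow> ?L")
    unfolding kuratowski_def
    by (rule Inf_ennreal_eq_0_iff, elim ex_forward conj_forward)
      (simp_all, meson diam_le_mono)
  also have "?L \<longleftrightarrow> ?R"
  proof (intro iffI allI impI)
    fix \<epsilon> :: real
    assume L: ?L and "0 < \<epsilon>"
    from L[rule_format, OF this(2)]
    obtain \<C> where \<C>: "finite \<C>" "S \<subseteq> \<Union>\<C>" "\<forall>C\<in>\<C>. diam_le C \<epsilon>"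
      by (elim exE conjE)
    \<comment> \<open>For an empty covering set the choice is arbitrary but harmless, as no point
      has to be located by it.\<close>
    define c where "c A = (SOME a. a \<in> A)" for A :: "'a set"
    have "x \<in> cball (c A) \<epsilon>" if "x \<in> A" "A \<in> \<C>" for x A
    proof -
      have "c A \<in> A" unfolding c_def using that(1) by (rule someI)
      from diam_leD[OF \<C>(3)[rule_format, OF that(2)] this that(1)] show ?thesis by simp
    qed
    then have "\<Union>\<C> \<subseteq> (\<Union>a\<in>c ` \<C>. cball a \<epsilon>)" by (intro Union_least subsetI) (rule UN_I[OF imageI])
    with \<C>(2) have "S \<subseteq> (\<Union>a\<in>c ` \<C>. cball a \<epsilon>)" by (rule order_trans)
    then show "\<exists>C. finite C \<and> S \<subseteq> (\<Union>c\<in>C. cball c \<epsilon>)"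
      by (intro exI[of _ "c ` \<C>"] conjI finite_imageI \<C>(1))
  next
    fix \<epsilon> :: real
    assume R: ?R and \<epsilon>: "0 < \<epsilon>"
    from R[rule_format, OF half_gt_zero[OF \<epsilon>]]
    obtain C where C: "finite C" "S \<subseteq> (\<Union>c\<in>C. cball c (\<epsilon> / 2))" by (elim exE conjE)
    have "diam_le (cball c (\<epsilon> / 2) \<inter> W) \<epsilon>" for c
    proof (rule diam_leI)
      show "dist x y \<le> \<epsilon>" if "x \<in> cball c (\<epsilon> / 2) \<inter> W" "y \<in> cball c (\<epsilon> / 2) \<inter> W" for x y
        using that dist_triangle3[of x y c] by auto
    qed (use \<epsilon> in simp)
    then have "\<forall>A\<in>(\<lambda>c. cball c (\<epsilon> / 2) \<inter> W) ` C. diam_le A \<epsilon>" by simp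
    moreover have "S \<subseteq> \<Union>((\<lambda>c. cball c (\<epsilon> / 2) \<inter> W) ` C)" using C(2) assms by auto
    moreover have "(\<lambda>c. cball c (\<epsilon> / 2) \<inter> W) ` C \<subseteq> Pow W" by auto
    ultimately show "\<exists>\<C>. finite \<C> \<and> \<C> \<subseteq> Pow W \<and> S \<subseteq> \<Union>\<C> \<and> (\<forall>C\<in>\<C>. diam_le C \<epsilon>)"
      by (intro exI conjI) (rule finite_imageI[OF C(1)])
  qed
  finally show ?thesis .
qed

text \<open>A supremum vanishes exactly when all its terms do, and singletons are compact, so
  quantifying over \<open>K\<close> reduces to quantifying over points.\<close>

lemma pointwise_tau_relatively_compact_iff:
  assumes "open \<Omega>" "M \<subseteq> Ck_on k \<Omega>"
  shows "pointwise_tau_relatively_compact k \<Omega> M \<longleftrightarrow>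
    (\<forall>p\<le>k. \<forall>x\<in>\<Omega>. \<forall>\<epsilon>>0. \<exists>C. finite C \<and> (\<lambda>f. differential p f x) ` M \<subseteq> (\<Union>c\<in>C. cball c \<epsilon>))"
proof -
  let ?Q = "\<lambda>p x. kuratowski (mlin_space p) ((\<lambda>f. differential p f x) ` M) = 0"
  have SUP0: "(SUP x\<in>K. h x) = 0 \<longleftrightarrow> (\<forall>x\<in>K. h x = 0)" for h :: "'a \<Rightarrow> ennreal" and K
    unfolding le_zero_eq[symmetric] SUP_le_iff ..
  have "pointwise_tau_relatively_compact k \<Omega> M \<longleftrightarrow>
      (\<forall>K. compact K \<and> K \<subseteq> \<Omega> \<longrightarrow> (\<forall>p\<le>k. \<forall>x\<in>K. ?Q p x))"
    unfolding pointwise_tau_relatively_compact_def mu_Dk_def Max_ennreal_eq_0_iff SUP0 ..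
  also have "\<dots> \<longleftrightarrow> (\<forall>p\<le>k. \<forall>x\<in>\<Omega>. ?Q p x)"
  proof (intro iffI allI impI ballI)
    fix p x
    assume *: "\<forall>K. compact K \<and> K \<subseteq> \<Omega> \<longrightarrow> (\<forall>p\<le>k. \<forall>x\<in>K. ?Q p x)" "p \<le> k" "x \<in> \<Omega>"
    show "?Q p x" by (rule *(1)[rule_format, of "{x}"]) (use *(2,3) in simp_all)
  next
    fix K p x
    assume "\<forall>p\<le>k. \<forall>x\<in>\<Omega>. ?Q p x" "compact K \<and> K \<subseteq> \<Omega>" "p \<le> k" "x \<in> K"
    then show "?Q p x" by (meson subsetD)
  qed
  also have "\<dots> \<longleftrightarrow> (\<forall>p\<le>k. \<forall>x\<in>\<Omega>. \<forall>\<epsilon>>0. \<exists>C. finite C \<and>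
      (\<lambda>f. differential p f x) ` M \<subseteq> (\<Union>c\<in>C. cball c \<epsilon>))"
  proof (rule all_cong, rule ball_cong[OF refl], rule kuratowski_eq_0_iff)
    show "(\<lambda>f. differential p f x) ` M \<subseteq> mlin_space p" if "p \<le> k" "x \<in> \<Omega>" for p x
      by (intro image_subsetI differential_in_mlin_space[OF assms(1) _ that] subsetD[OF assms(2)])
  qed
  finally show ?thesis .
qed


section \<open>Relatively compact sets\<close>

text \<open>The balls about all functions in \<open>Ck_on k \<Omega>\<close> form an open cover of
  the closure; the centres of a finite subcover are the net. The centres may lie outside
  \<open>M\<close>.\<close>

lemma Dk_relatively_compact_finite_net:
  fixes \<Omega> :: "'z::real_normed_vector set" and M :: "('z \<Rightarrow> 'y::real_normed_vector) set"
  assumes "open \<Omega>" "M \<subseteq> Ck_on k \<Omega>" "Dk_relatively_compact k \<Omega> M"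
    and "compact K" "K \<subseteq> \<Omega>" "0 < \<epsilon>"
  shows "\<exists>G. finite G \<and> G \<subseteq> Ck_on k \<Omega> \<and>
    (\<forall>f\<in>M. \<exists>g\<in>G. \<forall>p\<le>k. \<forall>x\<in>K. dist (differential p f x) (differential p g x) \<le> \<epsilon>)"
proof -
  let ?T = "Dk_topology k \<Omega> :: ('z \<Rightarrow> 'y) topology"
  define B where "B f = {g \<in> Ck_on k \<Omega>. \<exists>\<delta>\<ge>0. \<delta> < \<epsilon> \<and>
      (\<forall>p\<le>k. \<forall>x\<in>K. dist (differential p g x) (differential p f x) \<le> \<delta>)}" for f :: "'z \<Rightarrow> 'y"
  have "openin ?T (B f)" if "f \<in> Ck_on k \<Omega>" for f
    unfolding B_def by (rule openin_Dk_ball[OF assms(1) that assms(4-6)])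
  moreover have sub: "?T closure_of M \<subseteq> Ck_on k \<Omega>"
    using closure_of_subset_topspace[of ?T M] by (simp add: topspace_Dk_topology)
  moreover have "f \<in> B f" if "f \<in> Ck_on k \<Omega>" for f
    unfolding B_def using that assms(6) by (auto intro!: exI[of _ 0])
  ultimately have "\<exists>\<F>. finite \<F> \<and> \<F> \<subseteq> B ` Ck_on k \<Omega> \<and> ?T closure_of M \<subseteq> \<Union>\<F>"
    by (intro compactinD[OF assms(3)[unfolded Dk_relatively_compact_def]]) blast+
  then obtain \<F> where \<F>: "finite \<F>" "\<F> \<subseteq> B ` Ck_on k \<Omega>" "?T closure_of M \<subseteq> \<Union>\<F>"
    by blast
  obtain G where G: "G \<subseteq> Ck_on k \<Omega>" "finite G" "\<F> = B ` G"
    using finite_subset_image[OF \<F>(1,2)] by blast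
  have "M \<subseteq> ?T closure_of M"
    using assms(2) by (intro closure_of_subset) (simp add: topspace_Dk_topology)
  then have "M \<subseteq> (\<Union>g\<in>G. B g)" using \<F>(3) G(3) by auto
  moreover have "dist (differential p f x) (differential p g x) \<le> \<epsilon>"
    if "f \<in> B g" "p \<le> k" "x \<in> K" for f g p x
    using that unfolding B_def by fastforce
  ultimately have "\<forall>f\<in>M. \<exists>g\<in>G. \<forall>p\<le>k. \<forall>x\<in>K. dist (differential p f x) (differential p g x) \<le> \<epsilon>"
    by blast
  with G(1,2) show ?thesis by blast
qed

lemma finite_family_uniformly_continuous_on:
  assumes "finite G" "\<And>g. g \<in> G \<Longrightarrow> uniformly_continuous_on K g" "0 < \<epsilon>"
  shows "\<exists>d>0. \<forall>g\<in>G. \<forall>x\<in>K. \<forall>y\<in>K. dist x y < d \<longrightarrow> dist (g x) (g y) < \<epsilon>"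
  using assms(1,2)
proof (induction G rule: finite_induct)
  case empty
  then show ?case by (auto intro: exI[of _ 1])
next
  case (insert g G)
  obtain d where d: "d > 0" "\<forall>g\<in>G. \<forall>x\<in>K. \<forall>y\<in>K. dist x y < d \<longrightarrow> dist (g x) (g y) < \<epsilon>"
    using insert by auto
  obtain e where e: "e > 0" "\<forall>x\<in>K. \<forall>y\<in>K. dist x y < e \<longrightarrow> dist (g x) (g y) < \<epsilon>"
    using insert.prems[of g] assms(3) unfolding uniformly_continuous_on_def
    by (metis dist_commute insertI1)
  show ?case using d e by (intro exI[of _ "min d e"]) auto
qed

text \<open>Finitely many uniformly continuous functions share a modulus \<open>d\<close>, and the
  centres of a finite cover of \<open>K\<close> by balls of radius \<open>d\<close> serve them
  all.\<close>

lemma finite_family_oscillation: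
  fixes K :: "'a::metric_space set" and G :: "('a \<Rightarrow> 'b::metric_space) set"
  assumes "compact K" "finite G" "\<And>g. g \<in> G \<Longrightarrow> continuous_on K g" "0 < \<epsilon>"
  shows "\<exists>X. finite X \<and> X \<subseteq> K \<and> (\<forall>x\<in>K. \<exists>y\<in>X. \<forall>g\<in>G. dist (g x) (g y) \<le> \<epsilon>)"
proof -
  obtain d where d: "d > 0" "\<forall>g\<in>G. \<forall>x\<in>K. \<forall>y\<in>K. dist x y < d \<longrightarrow> dist (g x) (g y) < \<epsilon>"
    using finite_family_uniformly_continuous_on[OF assms(2) _ assms(4), of K]
      compact_uniformly_continuous[OF assms(3,1)] by blast
  obtain X where X: "X \<subseteq> K" "finite X" "K \<subseteq> (\<Union>y\<in>X. ball y d)"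
    by (rule compactE_image[OF assms(1), of K "\<lambda>y. ball y d"]) (use d(1) in auto)
  have "\<exists>y\<in>X. \<forall>g\<in>G. dist (g x) (g y) \<le> \<epsilon>" if "x \<in> K" for x
  proof -
    obtain y where "y \<in> X" "dist x y < d" using X(3) \<open>x \<in> K\<close> by (auto simp: dist_commute)
    then show ?thesis using d(2) X(1) \<open>x \<in> K\<close> by (meson in_mono less_imp_le)
  qed
  with X(1,2) show ?thesis by blast
qed

lemma Dk_relatively_compactD:
  fixes \<Omega> :: "'z::real_normed_vector set" and M :: "('z \<Rightarrow> 'y::real_normed_vector) set"
  assumes "open \<Omega>" "M \<subseteq> Ck_on k \<Omega>" "Dk_relatively_compact k \<Omega> M"
  shows "Dk_bounded k \<Omega> M" "tau_equicontinuous k \<Omega> M" "pointwise_tau_relatively_compact k \<Omega> M"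
proof -
  note net = Dk_relatively_compact_finite_net[OF assms]
  have "\<exists>C. \<forall>f\<in>M. Ck_seminorm k K f \<le> ennreal C" if K: "compact K" "K \<subseteq> \<Omega>" for K
  proof -
    from net[OF K zero_less_one] obtain G where G: "finite G" "G \<subseteq> Ck_on k \<Omega>"
      "\<forall>f\<in>M. \<exists>g\<in>G. \<forall>p\<le>k. \<forall>x\<in>K. dist (differential p f x) (differential p g x) \<le> 1"
      by (elim exE conjE)
    have "compact (differential p g ` K)" if "p \<le> k" "g \<in> G" for p g
      using that G(2)
      by (intro compact_continuous_image[OF continuous_on_subset[OF continuous_on_differential K(2)] K(1)])
        auto
    then have "bounded (\<Union>p\<le>k. \<Union>g\<in>G. differential p g ` K)"
      using G(1) by (intro bounded_UN finite_atMost ballI compact_imp_bounded) simp_all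
    then obtain C where C: "C > 0" "\<forall>u\<in>(\<Union>p\<le>k. \<Union>g\<in>G. differential p g ` K). norm u \<le> C"
      unfolding bounded_pos by (elim exE conjE)
    have "norm (differential p f x) \<le> C + 1" if "f \<in> M" "p \<le> k" "x \<in> K" for f p x
    proof -
      from bspec[OF G(3) that(1)] obtain g where g: "g \<in> G"
        "\<forall>p\<le>k. \<forall>x\<in>K. dist (differential p f x) (differential p g x) \<le> 1"
        by (elim bexE)
      have "norm (differential p g x) \<le> C"
        by (rule bspec[OF C(2)]) (use g(1) that(2,3) in auto)
      with g(2)[rule_format, OF that(2,3)] show ?thesis
        using norm_triangle_sub[of "differential p f x" "differential p g x"]
        by (simp add: dist_norm)
    qed
    then have "Ck_seminorm k K f \<le> ennreal (C + 1)" if "f \<in> M" for f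
      using C(1) that by (subst Ck_seminorm_le_iff) auto
    then show ?thesis by blast
  qed
  then show "Dk_bounded k \<Omega> M" using assms(2) by (simp add: Dk_bounded_def)
  show "tau_equicontinuous k \<Omega> M"
    unfolding tau_equicontinuous_def omega_Dk_eq_0_iff
  proof (intro allI impI, elim conjE)
    fix K and \<epsilon> :: real
    assume K: "compact K" "K \<subseteq> \<Omega>" and \<epsilon>: "0 < \<epsilon>"
    \<comment> \<open>One third each for passing from \<open>f\<close> to \<open>g\<close> at
      \<open>x\<close>, moving \<open>g\<close> from \<open>x\<close> to \<open>y\<close>, and
      returning to \<open>f\<close> at \<open>y\<close>.\<close>
    have \<epsilon>3: "0 < \<epsilon> / 3" using \<epsilon> by simp
    from net[OF K \<epsilon>3] obtain G where G: "finite G" "G \<subseteq> Ck_on k \<Omega>"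
      "\<forall>f\<in>M. \<exists>g\<in>G. \<forall>p\<le>k. \<forall>x\<in>K. dist (differential p f x) (differential p g x) \<le> \<epsilon> / 3"
      by (elim exE conjE)
    \<comment> \<open>Gathering all orders into one finite family makes \<open>X\<close> independent
      of \<open>p\<close>.\<close>
    define D where "D = (\<lambda>(p, g). differential p g) ` ({..k} \<times> G)"
    have D: "differential p g \<in> D" if "p \<le> k" "g \<in> G" for p g
      using that by (auto simp: D_def)
    have "finite D" using G(1) by (simp add: D_def)
    moreover have "continuous_on K h" if "h \<in> D" for h
    proof -
      obtain p g where "p \<le> k" "g \<in> G" "h = differential p g"
        using \<open>h \<in> D\<close> by (auto simp: D_def)
      then show ?thesis
        using G(2) continuous_on_subset[OF continuous_on_differential K(2)] by blast
    qed
    ultimately have "\<exists>X. finite X \<and> X \<subseteq> K \<and> (\<forall>x\<in>K. \<exists>y\<in>X. \<forall>h\<in>D. dist (h x) (h y) \<le> \<epsilon> / 3)"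
      by (intro finite_family_oscillation[OF K(1) _ _ \<epsilon>3])
    then obtain X where X: "finite X" "X \<subseteq> K" "\<forall>x\<in>K. \<exists>y\<in>X. \<forall>h\<in>D. dist (h x) (h y) \<le> \<epsilon> / 3"
      by (elim exE conjE)
    have "\<exists>y\<in>X. \<forall>f\<in>M. dist (differential p f x) (differential p f y) \<le> \<epsilon>"
      if p: "p \<le> k" and x: "x \<in> K" for p x
    proof -
      from bspec[OF X(3) x] obtain y where y: "y \<in> X" "\<forall>h\<in>D. dist (h x) (h y) \<le> \<epsilon> / 3"
        by (elim bexE)
      have "y \<in> K" using y(1) X(2) by blast
      have "dist (differential p f x) (differential p f y) \<le> \<epsilon>" if f: "f \<in> M" for f
      proof -
        from bspec[OF G(3) f] obtain g where g: "g \<in> G"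
          "\<forall>p\<le>k. \<forall>x\<in>K. dist (differential p f x) (differential p g x) \<le> \<epsilon> / 3"
          by (elim bexE)
        show ?thesis
          using g(2)[rule_format, OF p x] g(2)[rule_format, OF p \<open>y \<in> K\<close>]
            bspec[OF y(2) D[OF p g(1)]]
            dist_triangle[of "differential p f x" "differential p f y" "differential p g x"]
            dist_triangle2[of "differential p g x" "differential p f y" "differential p g y"]
          by linarith
      qed
      with y(1) show ?thesis by (intro bexI ballI)
    qed
    with X(1,2) show "\<exists>X. finite X \<and> X \<subseteq> K \<and>
        (\<forall>p\<le>k. \<forall>x\<in>K. \<exists>y\<in>X. \<forall>f\<in>M. dist (differential p f x) (differential p f y) \<le> \<epsilon>)"
      by (intro exI[of _ X] conjI allI impI ballI)
  qed
  show "pointwise_tau_relatively_compact k \<Omega> M"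
    unfolding pointwise_tau_relatively_compact_iff[OF assms(1,2)]
  proof (intro allI impI ballI)
    fix p x and \<epsilon> :: real
    assume p: "p \<le> k" and x: "x \<in> \<Omega>" and \<epsilon>: "0 < \<epsilon>"
    have "{x} \<subseteq> \<Omega>" using x by simp
    from net[OF compact_sing this \<epsilon>] obtain G where G: "finite G"
      "\<forall>f\<in>M. \<exists>g\<in>G. \<forall>p\<le>k. \<forall>x\<in>{x}. dist (differential p f x) (differential p g x) \<le> \<epsilon>"
      by (elim exE conjE)
    have "(\<lambda>f. differential p f x) ` M \<subseteq> (\<Union>c\<in>(\<lambda>g. differential p g x) ` G. cball c \<epsilon>)"
    proof (rule image_subsetI)
      fix f
      assume "f \<in> M"
      then obtain g where "g \<in> G" "dist (differential p f x) (differential p g x) \<le> \<epsilon>"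
        using G(2) p by blast
      then show "differential p f x \<in> (\<Union>c\<in>(\<lambda>g. differential p g x) ` G. cball c \<epsilon>)"
        by (intro UN_I[OF imageI]) (simp_all add: dist_commute)
    qed
    then show "\<exists>C. finite C \<and> (\<lambda>f. differential p f x) ` M \<subseteq> (\<Union>c\<in>C. cball c \<epsilon>)"
      by (intro exI[of _ "(\<lambda>g. differential p g x) ` G"] conjI finite_imageI G(1))
  qed
qed

section \<open>Sufficiency of the conditions\<close>

lemma compact_closure_if_totally_bounded:
  fixes S :: "'a::complete_space set"
  assumes "\<And>\<epsilon>. 0 < \<epsilon> \<Longrightarrow> \<exists>C. finite C \<and> S \<subseteq> (\<Union>c\<in>C. cball c \<epsilon>)"
  shows "compact (closure S)"
  unfolding compact_eq_totally_bounded
proof (intro conjI allI impI)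
  show "complete (closure S)" by (simp add: complete_eq_closed)
  fix \<epsilon> :: real
  assume \<epsilon>: "0 < \<epsilon>"
  \<comment> \<open>Closed balls of half the radius also contain the closure and fit into the open
    balls required.\<close>
  obtain C where C: "finite C" "S \<subseteq> (\<Union>c\<in>C. cball c (\<epsilon> / 2))"
    using assms[of "\<epsilon> / 2"] \<epsilon> by auto
  have "closure S \<subseteq> (\<Union>c\<in>C. cball c (\<epsilon> / 2))"
    using C by (intro closure_minimal closed_UN) auto
  also have "\<dots> \<subseteq> (\<Union>c\<in>C. ball c \<epsilon>)" using \<epsilon> by (intro UN_mono) auto
  finally show "\<exists>C. finite C \<and> closure S \<subseteq> (\<Union>c\<in>C. ball c \<epsilon>)" using C(1) by blast
qed

lemma Dk_relatively_compactI:
  fixes \<Omega> :: "'z::banach set" and M :: "('z \<Rightarrow> 'y::banach) set"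
  assumes "open \<Omega>" and M: "M \<subseteq> Ck_on k \<Omega>"
    and "tau_equicontinuous k \<Omega> M" "pointwise_tau_relatively_compact k \<Omega> M"
  shows "Dk_relatively_compact k \<Omega> M"
proof -
  define I where "I = {..k} \<times> \<Omega>"
  define T where "T = product_topology (\<lambda>_::nat \<times> 'z. euclidean :: ('z, 'y) mlin topology) I"
  define J where "J f = (\<lambda>(p, x)\<in>I. differential p f x)" for f :: "'z \<Rightarrow> 'y"
  define Q where "Q = T closure_of (J ` M)"
  let ?D = "Dk_topology k \<Omega> :: ('z \<Rightarrow> 'y) topology"
  have topT: "topspace T = extensional I"
    by (simp add: T_def PiE_UNIV_domain PiE_def)
  have QT: "Q \<subseteq> extensional I"
    unfolding Q_def topT[symmetric] by (rule closure_of_subset_topspace)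
  have J: "J f (p, x) = differential p f x" if "p \<le> k" "x \<in> \<Omega>" for f p x
    using that by (simp add: J_def I_def)
  have J_ext: "J f \<in> extensional I" for f by (simp add: J_def)
  have MQ: "J ` M \<subseteq> Q"
    unfolding Q_def by (rule closure_of_subset) (use J_ext topT in auto)

  have near: "\<exists>G. openin T G \<and> F \<in> G \<and> (\<forall>F'\<in>G. \<forall>p\<le>k. \<forall>y\<in>X. dist (F (p, y)) (F' (p, y)) < \<epsilon>)"
    if F: "F \<in> Q" and X: "finite X" "X \<subseteq> \<Omega>" and \<epsilon>: "0 < \<epsilon>" for F X and \<epsilon> :: real
  proof (intro exI conjI)
    \<comment> \<open>Only the finitely many coordinates in \<open>{..k} \<times> X\<close> are
      constrained, as a basic open set of the product demands.\<close>
    let ?B = "\<lambda>i. if i \<in> {..k} \<times> X then ball (F i) \<epsilon> else UNIV"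
    have "{i. ?B i \<noteq> UNIV} \<subseteq> {..k} \<times> X" by auto
    then have "finite {i. ?B i \<noteq> UNIV}" using X(1) finite_subset by blast
    then show "openin T (Pi\<^sub>E I ?B)"
      unfolding T_def by (intro product_topology_basis) auto
    have "F \<in> extensional I" using F QT by blast
    then show "F \<in> Pi\<^sub>E I ?B" using \<epsilon> by (simp add: PiE_iff)
    show "\<forall>F'\<in>Pi\<^sub>E I ?B. \<forall>p\<le>k. \<forall>y\<in>X. dist (F (p, y)) (F' (p, y)) < \<epsilon>"
    proof (intro ballI allI impI)
      fix F' p y
      assume F': "F' \<in> Pi\<^sub>E I ?B" and py: "p \<le> k" "y \<in> X"
      have "(p, y) \<in> I" using py X(2) by (auto simp: I_def)
      from PiE_mem[OF F' this] py show "dist (F (p, y)) (F' (p, y)) < \<epsilon>" by simp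
    qed
  qed
  have approx: "\<exists>f\<in>M. \<forall>p\<le>k. \<forall>y\<in>X. dist (F (p, y)) (differential p f y) < \<epsilon>"
    if F: "F \<in> Q" and X: "finite X" "X \<subseteq> \<Omega>" and \<epsilon>: "0 < \<epsilon>" for F X and \<epsilon> :: real
  proof -
    obtain G where G: "openin T G" "F \<in> G"
      "\<forall>F'\<in>G. \<forall>p\<le>k. \<forall>y\<in>X. dist (F (p, y)) (F' (p, y)) < \<epsilon>"
      using near[OF F X \<epsilon>] by (elim exE conjE)
    obtain f where f: "f \<in> M" "J f \<in> G"
      using F G(1,2) unfolding Q_def in_closure_of by blast
    have "dist (F (p, y)) (differential p f y) < \<epsilon>" if "p \<le> k" "y \<in> X" for p y
      using G(3)[rule_format, OF f(2) that] J[of p y f] that X(2) by auto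
    with f(1) show ?thesis by blast
  qed

  have equi: "\<exists>X. finite X \<and> X \<subseteq> K \<and>
      (\<forall>p\<le>k. \<forall>x\<in>K. \<exists>y\<in>X. \<forall>F\<in>Q. dist (F (p, x)) (F (p, y)) \<le> \<epsilon>)"
    if K: "compact K" "K \<subseteq> \<Omega>" and \<epsilon>: "0 < \<epsilon>" for K and \<epsilon> :: real
  proof -
    obtain X where X: "finite X" "X \<subseteq> K"
      "\<And>p x. p \<le> k \<Longrightarrow> x \<in> K \<Longrightarrow>
        \<exists>y\<in>X. \<forall>f\<in>M. dist (differential p f x) (differential p f y) \<le> \<epsilon>"
      using assms(3) K \<epsilon> unfolding tau_equicontinuous_def omega_Dk_eq_0_iff by meson
    have "\<exists>y\<in>X. \<forall>F\<in>Q. dist (F (p, x)) (F (p, y)) \<le> \<epsilon>" if p: "p \<le> k" and x: "x \<in> K" for p x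
    proof -
      obtain y where y: "y \<in> X" "\<And>f. f \<in> M \<Longrightarrow> dist (differential p f x) (differential p f y) \<le> \<epsilon>"
        using X(3)[OF p x] by blast
      \<comment> \<open>Equicontinuity passes to the closure: one \<open>f\<close> in
        \<open>M\<close> is close to \<open>F\<close> at both \<open>x\<close> and \<open>y\<close>,
        each contributing \<open>e / 2\<close>, and \<open>e\<close> is arbitrary.\<close>
      have "dist (F (p, x)) (F (p, y)) \<le> \<epsilon>" if F: "F \<in> Q" for F
      proof (rule field_le_epsilon)
        fix e :: real
        assume "0 < e"
        then obtain f where f: "f \<in> M" "dist (F (p, x)) (differential p f x) < e / 2"
          "dist (F (p, y)) (differential p f y) < e / 2"
          using approx[OF F, of "{x, y}" "e / 2"] p x y(1) X(2) K(2) by auto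
        then show "dist (F (p, x)) (F (p, y)) \<le> \<epsilon> + e"
          using y(2)[OF f(1)]
            dist_triangle[of "F (p, x)" "F (p, y)" "differential p f x"]
            dist_triangle2[of "differential p f x" "F (p, y)" "differential p f y"]
          by linarith
      qed
      with y(1) show ?thesis by blast
    qed
    with X(1,2) show ?thesis by blast
  qed
  \<comment> \<open>On \<open>Q\<close>, closeness at finitely many points of \<open>K\<close>
    forces uniform closeness on \<open>K\<close>. This serves twice: to approximate members of
    \<open>Q\<close> by jets, and to prove continuity of \<open>r\<close>.\<close>
  have unif: "\<exists>X. finite X \<and> X \<subseteq> K \<and> (\<forall>F\<in>Q. \<forall>F'\<in>Q.
      (\<forall>p\<le>k. \<forall>y\<in>X. dist (F (p, y)) (F' (p, y)) < \<epsilon> / 3) \<longrightarrow>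
      (\<forall>p\<le>k. \<forall>x\<in>K. dist (F (p, x)) (F' (p, x)) \<le> \<epsilon>))"
    if K: "compact K" "K \<subseteq> \<Omega>" and \<epsilon>: "0 < \<epsilon>" for K and \<epsilon> :: real
  proof -
    obtain X where X: "finite X" "X \<subseteq> K"
      "\<And>p x. p \<le> k \<Longrightarrow> x \<in> K \<Longrightarrow> \<exists>y\<in>X. \<forall>F\<in>Q. dist (F (p, x)) (F (p, y)) \<le> \<epsilon> / 3"
      using equi[OF K, of "\<epsilon> / 3"] \<epsilon> by auto
    have *: "dist (F (p, x)) (F' (p, x)) \<le> \<epsilon>"
      if F: "F \<in> Q" "F' \<in> Q" and d: "\<forall>p\<le>k. \<forall>y\<in>X. dist (F (p, y)) (F' (p, y)) < \<epsilon> / 3"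
        and p: "p \<le> k" and x: "x \<in> K" for F F' p x
    proof -
      obtain y where y: "y \<in> X" "dist (F (p, x)) (F (p, y)) \<le> \<epsilon> / 3"
        "dist (F' (p, x)) (F' (p, y)) \<le> \<epsilon> / 3"
        using X(3)[OF p x] F by blast
      have "dist (F (p, y)) (F' (p, y)) < \<epsilon> / 3" using d p y(1) by blast
      with y(2,3) show ?thesis
        using dist_triangle[of "F (p, x)" "F' (p, x)" "F (p, y)"]
          dist_triangle2[of "F (p, y)" "F' (p, x)" "F' (p, y)"] by linarith
    qed
    show ?thesis
      by (intro exI[of _ X] conjI X(1,2) ballI impI allI) (rule *; assumption)
  qed

  \<comment> \<open>Left inverse of \<open>J\<close> on C^k functions, and by \<open>QJ\<close> also
    a right inverse on \<open>Q\<close>.\<close>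
  define r where "r F = (\<lambda>x\<in>\<Omega>. mlin_apply (F (0, x)) [])" for F :: "nat \<times> 'z \<Rightarrow> ('z, 'y) mlin"
  have rJ: "r (J g) = g" if "g \<in> Ck_on k \<Omega>" for g
  proof
    show "r (J g) x = g x" for x
      using that by (cases "x \<in> \<Omega>") (auto simp: r_def J mlin_const.rep_eq Ck_on_def extensional_def)
  qed
  have QJ: "r F \<in> Ck_on k \<Omega> \<and> F = J (r F)" if F: "F \<in> Q" for F
  proof -
    have "\<exists>g\<in>Ck_on k \<Omega>. \<forall>p\<le>k. \<forall>x\<in>\<Omega>. differential p g x = F (p, x)"
    proof (rule Ck_on_complete[OF assms(1), where F = "\<lambda>p x. F (p, x)"])
      fix K and \<epsilon> :: real
      assume K: "compact K" "K \<subseteq> \<Omega>" and \<epsilon>: "0 < \<epsilon>"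
      obtain X where X: "finite X" "X \<subseteq> K" "\<forall>F\<in>Q. \<forall>F'\<in>Q.
          (\<forall>p\<le>k. \<forall>y\<in>X. dist (F (p, y)) (F' (p, y)) < \<epsilon> / 3) \<longrightarrow>
          (\<forall>p\<le>k. \<forall>x\<in>K. dist (F (p, x)) (F' (p, x)) \<le> \<epsilon>)"
        using unif[OF K \<epsilon>] by blast
      have "X \<subseteq> \<Omega>" using X(2) K(2) by blast
      obtain f where f: "f \<in> M" "\<forall>p\<le>k. \<forall>y\<in>X. dist (F (p, y)) (differential p f y) < \<epsilon> / 3"
        using approx[OF F X(1) \<open>X \<subseteq> \<Omega>\<close>, of "\<epsilon> / 3"] \<epsilon> by auto
      have "\<forall>p\<le>k. \<forall>y\<in>X. dist (F (p, y)) (J f (p, y)) < \<epsilon> / 3"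
        using f(2) \<open>X \<subseteq> \<Omega>\<close> by (auto simp: J subset_iff)
      moreover have "J f \<in> Q" using MQ f(1) by blast
      ultimately have "\<forall>p\<le>k. \<forall>x\<in>K. dist (F (p, x)) (J f (p, x)) \<le> \<epsilon>"
        using X(3) F by blast
      then have "\<forall>p\<le>k. \<forall>x\<in>K. dist (differential p f x) (F (p, x)) \<le> \<epsilon>"
        using K(2) by (auto simp: J subset_iff dist_commute)
      then show "\<exists>f\<in>Ck_on k \<Omega>. \<forall>p\<le>k. \<forall>x\<in>K. dist (differential p f x) (F (p, x)) \<le> \<epsilon>"
        using f(1) M by blast
    qed
    then obtain g where g: "g \<in> Ck_on k \<Omega>" "\<forall>p\<le>k. \<forall>x\<in>\<Omega>. differential p g x = F (p, x)"
      by blast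
    have "F = J g"
    proof (rule extensionalityI[of _ I])
      show "F \<in> extensional I" using F QT by blast
      show "F i = J g i" if "i \<in> I" for i
        using that g(2) by (auto simp: I_def J)
    qed (rule J_ext)
    with g(1) rJ show ?thesis by simp
  qed

  have "compactin T Q"
  proof -
    \<comment> \<open>The product of compact closures is both compact and closed in
      \<open>T\<close>, hence it contains \<open>Q\<close> as a closed subset.\<close>
    define P where "P = Pi\<^sub>E I (\<lambda>(p, x). closure ((\<lambda>f. differential p f x) ` M))"
    have "compact (closure ((\<lambda>f. differential p f x) ` M))" if "p \<le> k" "x \<in> \<Omega>" for p x
      using assms(4) that unfolding pointwise_tau_relatively_compact_iff[OF assms(1,2)]
      by (intro compact_closure_if_totally_bounded) blast
    then have compP: "compactin T P"
      unfolding P_def T_def compactin_PiE by (auto simp: I_def)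
    have "closedin T P"
      unfolding P_def T_def closedin_product_topology by auto
    moreover have "J ` M \<subseteq> P"
    proof (rule image_subsetI)
      fix f
      assume f: "f \<in> M"
      have "differential p f x \<in> closure ((\<lambda>f. differential p f x) ` M)" for p x
        by (rule subsetD[OF closure_subset imageI[OF f]])
      then show "J f \<in> P" by (auto simp: P_def PiE_iff J_def)
    qed
    ultimately have "Q \<subseteq> P" unfolding Q_def by (intro closure_of_minimal)
    with compP show ?thesis unfolding Q_def by (rule closed_compactin[OF _ _ closedin_closure_of])
  qed
  then have compQ: "compactin (subtopology T Q) Q" by (simp add: compactin_subtopology)
  have topQ: "topspace (subtopology T Q) = Q" using QT topT by auto

  have "continuous_map (subtopology T Q) ?D r"
    unfolding Dk_topology_def
  proof (rule continuous_on_generated_topo)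
    fix U :: "('z \<Rightarrow> 'y) set"
    assume "U \<in> {{g \<in> Ck_on k \<Omega>. Ck_seminorm k K (\<lambda>x\<in>\<Omega>. g x - f x) < ennreal \<epsilon>} | f K \<epsilon>.
        f \<in> Ck_on k \<Omega> \<and> compact K \<and> K \<subseteq> \<Omega> \<and> 0 < \<epsilon>}"
    then obtain f K \<epsilon> where "U = {g \<in> Ck_on k \<Omega>. Ck_seminorm k K (\<lambda>x\<in>\<Omega>. g x - f x) < ennreal \<epsilon>}"
      and f: "f \<in> Ck_on k \<Omega>" and K: "compact K" "K \<subseteq> \<Omega>" and \<epsilon>: "0 < \<epsilon>"
      by blast
    then have U: "U = {g \<in> Ck_on k \<Omega>. \<exists>\<delta>\<ge>0. \<delta> < \<epsilon> \<and>
        (\<forall>p\<le>k. \<forall>x\<in>K. dist (differential p g x) (differential p f x) \<le> \<delta>)}"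
      by (simp only: Dk_ball_eq[OF assms(1) f K(2) \<epsilon>])
    show "openin (subtopology T Q) (r -` U \<inter> topspace (subtopology T Q))"
      unfolding topQ
    proof (subst openin_subopen, intro ballI)
      fix F
      assume F: "F \<in> r -` U \<inter> Q"
      then obtain \<delta> where \<delta>: "0 \<le> \<delta>" "\<delta> < \<epsilon>"
        "\<And>p x. p \<le> k \<Longrightarrow> x \<in> K \<Longrightarrow> dist (differential p (r F) x) (differential p f x) \<le> \<delta>"
        unfolding U by blast
      \<comment> \<open>Half the gap, so that \<open>\<delta> + \<eta>\<close> is still strictly
        below \<open>\<epsilon>\<close>.\<close>
      define \<eta> where "\<eta> = (\<epsilon> - \<delta>) / 2"
      have \<eta>: "0 < \<eta>" using \<delta>(2) by (simp add: \<eta>_def)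
      obtain X where X: "finite X" "X \<subseteq> K" "\<forall>F\<in>Q. \<forall>F'\<in>Q.
          (\<forall>p\<le>k. \<forall>y\<in>X. dist (F (p, y)) (F' (p, y)) < \<eta> / 3) \<longrightarrow>
          (\<forall>p\<le>k. \<forall>x\<in>K. dist (F (p, x)) (F' (p, x)) \<le> \<eta>)"
        using unif[OF K \<eta>] by blast
      obtain G where G: "openin T G" "F \<in> G"
        "\<forall>F'\<in>G. \<forall>p\<le>k. \<forall>y\<in>X. dist (F (p, y)) (F' (p, y)) < \<eta> / 3"
        using near[of F X "\<eta> / 3"] F X(1,2) K(2) \<eta> by auto
      have "F' \<in> r -` U" if F': "F' \<in> G \<inter> Q" for F'
      proof -
        have d: "dist (F (p, x)) (F' (p, x)) \<le> \<eta>" if "p \<le> k" "x \<in> K" for p x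
          using X(3) G(3) F F' that by blast
        have "dist (differential p (r F') x) (differential p f x) \<le> \<delta> + \<eta>"
          if p: "p \<le> k" and x: "x \<in> K" for p x
        proof -
          have "F (p, x) = differential p (r F) x" "F' (p, x) = differential p (r F') x"
            using QJ[of F] QJ[of F'] F F' J[of p x] p x K(2) by (metis IntD2 subsetD)+
          then show ?thesis
            using d[OF p x] \<delta>(3)[OF p x]
              dist_triangle3[of "differential p (r F') x" "differential p f x" "differential p (r F) x"]
            by simp
        qed
        moreover have "0 \<le> \<delta> + \<eta>" "\<delta> + \<eta> < \<epsilon>" using \<delta>(1,2) by (auto simp: \<eta>_def field_simps)
        moreover have "r F' \<in> Ck_on k \<Omega>" using QJ F' by blast
        ultimately show ?thesis unfolding U by blast
      qed
      then show "\<exists>V. openin (subtopology T Q) V \<and> F \<in> V \<and> V \<subseteq> r -` U \<inter> Q"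
        using G(1,2) F by (intro exI[of _ "G \<inter> Q"]) (auto simp: openin_subtopology)
    qed
  next
    have "r ` topspace (subtopology T Q) \<subseteq> topspace ?D"
      unfolding topQ topspace_Dk_topology using QJ by blast
    then show "r ` topspace (subtopology T Q) \<subseteq> \<Union> {{g \<in> Ck_on k \<Omega>.
        Ck_seminorm k K (\<lambda>x\<in>\<Omega>. g x - f x) < ennreal \<epsilon>} | f K \<epsilon>.
        f \<in> Ck_on k \<Omega> \<and> compact K \<and> K \<subseteq> \<Omega> \<and> 0 < \<epsilon>}"
      unfolding Dk_topology_def topology_generated_by_topspace .
  qed
  from image_compactin[OF compQ this] have "compactin ?D (r ` Q)" .
  \<comment> \<open>Continuity of \<open>J\<close> sends the closure of \<open>M\<close> into
    \<open>Q\<close>, and \<open>r\<close> recovers each function from its jet. The closure is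
    thereby a closed subset of the compact image of \<open>Q\<close> under \<open>r\<close>.\<close>
  moreover have "?D closure_of M \<subseteq> r ` Q"
  proof
    have "continuous_map ?D T J"
      unfolding T_def continuous_map_componentwise
    proof (intro conjI ballI)
      show "J ` topspace ?D \<subseteq> extensional I" using J_ext by blast
    next
      fix i
      assume "i \<in> I"
      then obtain p x where i: "i = (p, x)" and p: "p \<le> k" and x: "x \<in> \<Omega>"
        by (auto simp: I_def)
      show "continuous_map ?D euclidean (\<lambda>f. J f i)"
        unfolding continuous_map_def
      proof (intro conjI allI impI)
        fix V :: "('z, 'y) mlin set"
        assume "openin euclidean V"
        then have V: "open V" by simp
        show "openin ?D {f \<in> topspace ?D. J f i \<in> V}"
          unfolding topspace_Dk_topology
        proof (subst openin_subopen, intro ballI)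
          fix f
          assume f: "f \<in> {f \<in> Ck_on k \<Omega>. J f i \<in> V}"
          then obtain \<epsilon> where \<epsilon>: "0 < \<epsilon>" "ball (differential p f x) \<epsilon> \<subseteq> V"
            using V J[OF p x] by (auto simp: i open_contains_ball)
          \<comment> \<open>The seminorm for the compact set \<open>{x}\<close> controls the
            coordinate \<open>(p, x)\<close>.\<close>
          let ?B = "{g \<in> Ck_on k \<Omega>. \<exists>\<delta>\<ge>0. \<delta> < \<epsilon> \<and>
            (\<forall>p\<le>k. \<forall>x\<in>{x}. dist (differential p g x) (differential p f x) \<le> \<delta>)}"
          have "openin ?D ?B"
            using openin_Dk_ball[OF assms(1) _ compact_sing[of x] _ \<epsilon>(1)] f x by blast
          moreover have "f \<in> ?B" using f \<epsilon>(1) by (auto intro!: exI[of _ 0])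
          moreover have "J g i \<in> V" if "g \<in> ?B" for g
          proof -
            have "dist (differential p f x) (differential p g x) < \<epsilon>"
              using that p by (auto simp: dist_commute)
            then show ?thesis using \<epsilon>(2) J[OF p x] by (auto simp: i)
          qed
          ultimately show "\<exists>W. openin ?D W \<and> f \<in> W \<and> W \<subseteq> {f \<in> Ck_on k \<Omega>. J f i \<in> V}"
            by blast
        qed
      qed simp
    qed
    then have "J ` (?D closure_of M) \<subseteq> Q"
      unfolding Q_def by (rule continuous_map_image_closure_subset)
    moreover fix g
    assume g: "g \<in> ?D closure_of M"
    ultimately have "J g \<in> Q" by blast
    moreover have "g \<in> Ck_on k \<Omega>"
      using g closure_of_subset_topspace[of ?D M] by (auto simp: topspace_Dk_topology)
    ultimately show "g \<in> r ` Q" using rJ by force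
  qed
  ultimately show ?thesis
    unfolding Dk_relatively_compact_def by (rule closed_compactin) simp
qed

theorem corollary4p7:
  fixes \<Omega> :: "'z::banach set" and k :: nat and M :: "('z \<Rightarrow> 'y::banach) set"
  assumes "open \<Omega>" "\<Omega> \<noteq> {}" "M \<subseteq> Ck_on k \<Omega>"
  shows "Dk_relatively_compact k \<Omega> M \<longleftrightarrow>
     Dk_bounded k \<Omega> M \<and> tau_equicontinuous k \<Omega> M \<and> pointwise_tau_relatively_compact k \<Omega> M"
  using Dk_relatively_compactD[OF assms(1,3)] Dk_relatively_compactI[OF assms(1,3)] by blast

end
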